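(* Let $\Omega\subset\mathbb{R}^n$, $n\ge 2$, be a bounded domain, let $a\in C(\Omega)\cap L^\infty(\Omega)$ with $\inf_{x\in\Omega}a(x)>0$, and let $0\le\lambda<\lambda_\Omega$. Suppose that $h\in C(\Omega)\cap L^\infty(\Omega)$ and $b\in C(\partial\Omega)$. Then there is a function $u\in C(\overline{\Omega})$ that solves the Dirichlet problem $$\Delta_\infty u+\lambda a(x)u^3=h(x)\ \text{ in }\Omega,\quad\text{and}\quad u=b\ \text{ on }\partial\Omega.$$
   Context: The infinity-Laplacian is $\Delta_\infty u=\sum_{i,j=1}^n \frac{\partial u}{\partial x_i}\frac{\partial u}{\partial x_j}\frac{\partial^2 u}{\partial x_i\partial x_j}$. Differential equations are understood in the viscosity sense: for $F\in C(\Omega\times\mathbb{R})$, a function $u\in C(\Omega)$ satisfies $\Delta_\infty u\ge F(x,u)$ in $\Omega$ if, whenever $\psi\in C^2(\Omega)$ and $u-\psi$ has a local maximum at $p\in\Omega$, one has $\Delta_\infty\psi(p)\ge F(p,u(p))$; it satisfies $\Delta_\infty u\le F(x,u)$ in $\Omega$ if, whenever $\psi\in C^2(\Omega)$ and $u-\psi$ has a local minimum at $q\in\Omega$, one has $\Delta_\infty\psi(q)\le F(q,u(q))$; $\Delta_\infty u=F(x,u)$ means both. Here $\Delta_\infty u+\lambda a(x)u^3=h(x)$ means $\Delta_\infty u=h(x)-\lambda a(x)u^3$. The first (principal) eigenvalue $\lambda_\Omega$ (with weight $a$) is $\lambda_\Omega=\sup S$, where, for a fixed $\delta>0$, $S$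 is the set of all $\lambda\ge 0$ such that the problem $\Delta_\infty u+\lambda a(x)u^3=0$ in $\Omega$, $u=\delta$ on $\partial\Omega$, has a positive solution $u\in C(\overline{\Omega})$. By scaling, $S$ does not depend on $\delta>0$. *)

theory Defs
  imports "HOL-Analysis.Analysis"
begin

text \<open>
  Functions on a set are rendered as total functions on the ambient space; only their values on
  the set matter. Partial derivatives are only used at points of an open set where the function
  in question is Frechet differentiable.
\<close>

definition partial_deriv :: "'n::finite \<Rightarrow> (real ^ 'n \<Rightarrow> real) \<Rightarrow> real ^ 'n \<Rightarrow> real" where
  "partial_deriv i f x = frechet_derivative f (at x) (axis i 1)"

definition C1_on :: "(real ^ 'n::finite) set \<Rightarrow> (real ^ 'n \<Rightarrow> real) \<Rightarrow> bool" where
  "C1_on \<Omega> f \<longleftrightarrow>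
     (\<forall>x\<in>\<Omega>. f differentiable (at x)) \<and> (\<forall>i. continuous_on \<Omega> (partial_deriv i f))"

definition C2_on :: "(real ^ 'n::finite) set \<Rightarrow> (real ^ 'n \<Rightarrow> real) \<Rightarrow> bool" where
  "C2_on \<Omega> f \<longleftrightarrow> C1_on \<Omega> f \<and> (\<forall>i. C1_on \<Omega> (partial_deriv i f))"

definition inf_laplacian :: "(real ^ 'n::finite \<Rightarrow> real) \<Rightarrow> real ^ 'n \<Rightarrow> real" where
  "inf_laplacian u x =
     (\<Sum>i\<in>UNIV. \<Sum>j\<in>UNIV.
        partial_deriv i u x * partial_deriv j u x * partial_deriv i (partial_deriv j u) x)"

definition local_max_in :: "'a::metric_space set \<Rightarrow> ('a \<Rightarrow> real) \<Rightarrow> 'a \<Rightarrow> bool" where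
  "local_max_in \<Omega> g p \<longleftrightarrow> p \<in> \<Omega> \<and> (\<exists>r>0. \<forall>x\<in>\<Omega> \<inter> ball p r. g x \<le> g p)"

definition local_min_in :: "'a::metric_space set \<Rightarrow> ('a \<Rightarrow> real) \<Rightarrow> 'a \<Rightarrow> bool" where
  "local_min_in \<Omega> g p \<longleftrightarrow> p \<in> \<Omega> \<and> (\<exists>r>0. \<forall>x\<in>\<Omega> \<inter> ball p r. g p \<le> g x)"

text \<open>
  The inequality (Laplacian of \<open>u\<close>) \<open>\<ge> F(x,u)\<close>, respectively \<open>\<le> F(x,u)\<close>, in the viscosity sense.
  The intended right-hand sides \<open>F\<close> are continuous on \<open>\<Omega> \<times> UNIV\<close>.
\<close>

definition visc_ge ::
  "(real ^ 'n::finite) set \<Rightarrow> (real ^ 'n \<Rightarrow> real \<Rightarrow> real) \<Rightarrow> (real ^ 'n \<Rightarrow> real) \<Rightarrow> bool" where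
  "visc_ge \<Omega> F u \<longleftrightarrow>
     continuous_on \<Omega> u \<and>
     (\<forall>\<psi> p. C2_on \<Omega> \<psi> \<longrightarrow> local_max_in \<Omega> (\<lambda>x. u x - \<psi> x) p \<longrightarrow> inf_laplacian \<psi> p \<ge> F p (u p))"

definition visc_le ::
  "(real ^ 'n::finite) set \<Rightarrow> (real ^ 'n \<Rightarrow> real \<Rightarrow> real) \<Rightarrow> (real ^ 'n \<Rightarrow> real) \<Rightarrow> bool" where
  "visc_le \<Omega> F u \<longleftrightarrow>
     continuous_on \<Omega> u \<and>
     (\<forall>\<psi> q. C2_on \<Omega> \<psi> \<longrightarrow> local_min_in \<Omega> (\<lambda>x. u x - \<psi> x) q \<longrightarrow> inf_laplacian \<psi> q \<le> F q (u q))"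

definition visc_solution ::
  "(real ^ 'n::finite) set \<Rightarrow> (real ^ 'n \<Rightarrow> real \<Rightarrow> real) \<Rightarrow> (real ^ 'n \<Rightarrow> real) \<Rightarrow> bool" where
  "visc_solution \<Omega> F u \<longleftrightarrow> visc_ge \<Omega> F u \<and> visc_le \<Omega> F u"

definition dirichlet_solution ::
  "(real ^ 'n::finite) set \<Rightarrow> (real ^ 'n \<Rightarrow> real) \<Rightarrow> real \<Rightarrow> (real ^ 'n \<Rightarrow> real) \<Rightarrow>
   (real ^ 'n \<Rightarrow> real) \<Rightarrow> (real ^ 'n \<Rightarrow> real) \<Rightarrow> bool" where
  "dirichlet_solution \<Omega> a \<mu> h b u \<longleftrightarrow>
     continuous_on (closure \<Omega>) u \<and>
     visc_solution \<Omega> (\<lambda>x t. h x - \<mu> * a x * t ^ 3) u \<and>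
     (\<forall>x\<in>frontier \<Omega>. u x = b x)"

definition eigen_set ::
  "real \<Rightarrow> (real ^ 'n::finite) set \<Rightarrow> (real ^ 'n \<Rightarrow> real) \<Rightarrow> real set" where
  "eigen_set \<delta> \<Omega> a =
     {\<mu>. \<mu> \<ge> 0 \<and> (\<exists>u. dirichlet_solution \<Omega> a \<mu> (\<lambda>_. 0) (\<lambda>_. \<delta>) u \<and> (\<forall>x\<in>\<Omega>. u x > 0))}"

text \<open>
  The supremum is taken in the extended reals, so that it is meaningful without first proving
  that the set is bounded above.
\<close>

definition principal_eigenvalue ::
  "real \<Rightarrow> (real ^ 'n::finite) set \<Rightarrow> (real ^ 'n \<Rightarrow> real) \<Rightarrow> ereal" where
  "principal_eigenvalue \<delta> \<Omega> a = Sup (ereal ` eigen_set \<delta> \<Omega> a)"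

definition Linfty_on :: "(real ^ 'n::finite) set \<Rightarrow> (real ^ 'n \<Rightarrow> real) \<Rightarrow> bool" where
  "Linfty_on \<Omega> f \<longleftrightarrow>
     f \<in> borel_measurable (lebesgue_on \<Omega>) \<and> (\<exists>C. AE x in lebesgue_on \<Omega>. \<bar>f x\<bar> \<le> C)"

end

theory Submission
  imports Defs
begin

text \<open>
  The solution is the largest subsolution between a sub- and a supersolution (Perron's method).

  Since \<open>\<mu>\<close> is below the principal eigenvalue, there is a positive solution \<open>v\<close> of the homogeneous problem for
  some \<open>\<mu>' > \<mu>\<close>. It is bounded away from zero, so for the parameter \<open>\<mu>\<close> it is a supersolution with a uniform
  surplus \<open>(\<mu>' - \<mu>) a v\<^sup>3\<close>. The equation is homogeneous of degree three: for a large factor \<open>k\<close> the surplus of \<open>k v\<close>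
  exceeds \<open>\<bar>h\<bar>\<close>, and \<open>k v\<close> exceeds \<open>\<bar>b\<bar>\<close>. Hence \<open>k v\<close> is a supersolution and, by oddness, \<open>- k v\<close> a subsolution.

  The zeroth-order term has the wrong sign for a comparison principle, so a subsolution with the right boundary
  values need not lie below the supersolution. The supremum is therefore taken over those subsolutions that
  do lie below \<open>V = k v\<close>. When the supremum \<open>u\<close> fails to be a supersolution at a point where \<open>u < V\<close>, a bump shows that it is not maximal; where \<open>u = V\<close>, every function
  touching \<open>u\<close> from below touches \<open>V\<close> as well (\<open>envelope_visc_le\<close>).

  What remains is continuity. On the relevant range of values the right-hand side is bounded by a constant
  \<open>C\<close>, so every subsolution \<open>w\<close> in the class satisfies \<open>\<Delta>\<^sub>\<infinity> w \<ge> - C\<close>, and it can be compared with the concave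
  cones \<open>c + K r - C r\<^sup>2\<close>, \<open>r\<close> being the distance to a vertex, whose infinity-Laplacian is strictly below \<open>- C\<close> while
  their slope is at least one (\<open>cone_comparison\<close>). Cones with interior vertices give local Lipschitz bounds
  that are uniform over the class (\<open>subs_locally_lipschitz\<close>), so that the supremum is continuous and is again
  a subsolution. Cones with vertices on the boundary, upright and inverted, are barriers at every boundary point
  (\<open>envelope_le_boundary_cone\<close>, \<open>boundary_cone_le_envelope\<close>), so the boundary values are attained continuously
  whatever the shape of the boundary.
\<close>

section \<open>Calculus of twice continuously differentiable functions\<close>

lemma partial_deriv_eq:
  assumes "(f has_derivative f') (at x)"
  shows "partial_deriv i f x = f' (axis i 1)"
  using frechet_derivative_at[OF assms] by (simp add: partial_deriv_def)

lemma partial_deriv_cong_open: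
  assumes "open S" "x \<in> S" "\<And>y. y \<in> S \<Longrightarrow> f y = g y"
  shows "partial_deriv i f x = partial_deriv i g x"
proof -
  have "(f has_derivative f') (at x) \<longleftrightarrow> (g has_derivative f') (at x)" for f'
    using has_derivative_transform_within_open[OF _ assms(1,2), of f f' UNIV g]
      has_derivative_transform_within_open[OF _ assms(1,2), of g f' UNIV f] assms(3)
    by metis
  then show ?thesis by (simp add: partial_deriv_def frechet_derivative_def)
qed

lemma C1_on_cong:
  assumes "open S" "\<And>y. y \<in> S \<Longrightarrow> f y = g y" "C1_on S f"
  shows "C1_on S g"
proof -
  have "g differentiable (at x)" if "x \<in> S" for x
  proof -
    have "f differentiable (at x)" using assms(3) that by (simp add: C1_on_def)
    then obtain f' where "(f has_derivative f') (at x)" unfolding differentiable_def ..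
    then have "(g has_derivative f') (at x)"
      by (rule has_derivative_transform_within_open[OF _ assms(1) that assms(2)])
    then show ?thesis by (auto simp: differentiable_def)
  qed
  moreover have "continuous_on S (partial_deriv i g)" for i
  proof (rule continuous_on_eq)
    show "continuous_on S (partial_deriv i f)" using assms(3) by (simp add: C1_on_def)
    show "partial_deriv i f x = partial_deriv i g x" if "x \<in> S" for x
      by (rule partial_deriv_cong_open[OF assms(1) that assms(2)])
  qed
  ultimately show ?thesis by (simp add: C1_on_def)
qed

lemma partial_deriv_lincomb:
  assumes "f differentiable (at x)" "g differentiable (at x)"
  shows "partial_deriv i (\<lambda>x. \<alpha> * f x + \<beta> * g x) x
    = \<alpha> * partial_deriv i f x + \<beta> * partial_deriv i g x"
proof -
  have "((\<lambda>x. \<alpha> * f x + \<beta> * g x) has_derivative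
      (\<lambda>v. \<alpha> * frechet_derivative f (at x) v + \<beta> * frechet_derivative g (at x) v)) (at x)"
    using assms by (auto intro!: derivative_eq_intros simp: frechet_derivative_works)
  then show ?thesis by (simp add: partial_deriv_eq) (simp add: partial_deriv_def)
qed

lemma C1_on_lincomb:
  assumes "C1_on S f" "C1_on S g"
  shows "C1_on S (\<lambda>x. \<alpha> * f x + \<beta> * g x)"
proof -
  have "continuous_on S (\<lambda>x. \<alpha> * partial_deriv i f x + \<beta> * partial_deriv i g x)" for i
    using assms by (auto simp: C1_on_def intro!: continuous_intros)
  then have "continuous_on S (partial_deriv i (\<lambda>x. \<alpha> * f x + \<beta> * g x))" for i
    using assms by (auto simp: C1_on_def partial_deriv_lincomb cong: continuous_on_cong)
  then show ?thesis using assms by (auto simp: C1_on_def)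
qed

lemma C2_on_lincomb:
  assumes "open S" "C2_on S f" "C2_on S g"
  shows "C2_on S (\<lambda>x. \<alpha> * f x + \<beta> * g x)"
proof -
  have "C1_on S (partial_deriv i (\<lambda>x. \<alpha> * f x + \<beta> * g x))" for i
  proof (rule C1_on_cong[OF \<open>open S\<close>])
    show "C1_on S (\<lambda>x. \<alpha> * partial_deriv i f x + \<beta> * partial_deriv i g x)"
      using assms by (auto simp: C2_on_def intro: C1_on_lincomb)
  qed (use assms in \<open>auto simp: C2_on_def C1_on_def partial_deriv_lincomb\<close>)
  then show ?thesis using assms by (auto simp: C2_on_def intro: C1_on_lincomb)
qed

lemma partial_deriv2_lincomb:
  assumes "open S" "C2_on S f" "C2_on S g" "x \<in> S"
  shows "partial_deriv i (partial_deriv j (\<lambda>x. \<alpha> * f x + \<beta> * g x)) x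
    = \<alpha> * partial_deriv i (partial_deriv j f) x + \<beta> * partial_deriv i (partial_deriv j g) x"
proof -
  have "partial_deriv i (partial_deriv j (\<lambda>x. \<alpha> * f x + \<beta> * g x)) x
      = partial_deriv i (\<lambda>x. \<alpha> * partial_deriv j f x + \<beta> * partial_deriv j g x) x"
    by (rule partial_deriv_cong_open[OF assms(1,4)])
       (use assms in \<open>auto simp: C2_on_def C1_on_def partial_deriv_lincomb\<close>)
  then show ?thesis using assms by (simp add: C2_on_def C1_on_def partial_deriv_lincomb)
qed

lemma continuous_on_inf_laplacian:
  "C2_on S f \<Longrightarrow> continuous_on S (inf_laplacian f)"
  unfolding inf_laplacian_def[abs_def] C2_on_def C1_on_def by (intro continuous_intros) auto

lemma C2_on_imp_continuous_on: "C2_on S f \<Longrightarrow> continuous_on S f"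
  unfolding C2_on_def C1_on_def
  by (meson continuous_at_imp_continuous_on differentiable_imp_continuous_within)

lemma inf_laplacian_scale:
  assumes "open S" "C2_on S f" "x \<in> S"
  shows "C2_on S (\<lambda>x. c * f x)" "inf_laplacian (\<lambda>x. c * f x) x = c ^ 3 * inf_laplacian f x"
proof -
  show "C2_on S (\<lambda>x. c * f x)" using C2_on_lincomb[OF assms(1,2,2), of c 0] by simp
  have "partial_deriv i (\<lambda>x. c * f x) x = c * partial_deriv i f x" for i
    using partial_deriv_lincomb[of f x f i c 0] assms by (auto simp: C2_on_def C1_on_def)
  moreover have "partial_deriv i (partial_deriv j (\<lambda>x. c * f x)) x
      = c * partial_deriv i (partial_deriv j f) x" for i j
    using partial_deriv2_lincomb[OF assms(1,2,2,3), of i j c 0] by simp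
  ultimately show "inf_laplacian (\<lambda>x. c * f x) x = c ^ 3 * inf_laplacian f x"
    by (simp add: inf_laplacian_def sum_distrib_left power3_eq_cube mult_ac)
qed

text \<open>
  The link between partial derivatives, which is what the infinity-Laplacian is built from, and
  derivatives along lines, where one-variable calculus applies.
\<close>

lemma frechet_derivative_eq_sum_partial:
  assumes "f differentiable (at x)"
  shows "frechet_derivative f (at x) \<xi> = (\<Sum>i\<in>UNIV. \<xi> $ i * partial_deriv i f x)"
proof -
  have lin: "linear (frechet_derivative f (at x))"
    using assms linear_frechet_derivative by blast
  have "frechet_derivative f (at x) \<xi> = frechet_derivative f (at x) (\<Sum>i\<in>UNIV. (\<xi> $ i) *s axis i 1)"
    by (simp only: basis_expansion)
  then show ?thesis
    by (simp add: linear_sum[OF lin] linear_cmul[OF lin] scalar_mult_eq_scaleR partial_deriv_def)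
qed

text \<open>
  The second-order condition is read off from the restriction of \<open>k\<close> to a line through \<open>p\<close>: if the
  second derivative along \<open>\<xi>\<close> were positive, the first derivative, which vanishes at \<open>p\<close>, would be
  positive just after \<open>p\<close>, and \<open>k\<close> would increase there.
\<close>

lemma local_max_second_order:
  assumes "open S" "C2_on S k" "local_max_in S k p"
  shows "partial_deriv i k p = 0"
    and "(\<Sum>j\<in>UNIV. \<Sum>i\<in>UNIV. \<xi> $ i * \<xi> $ j * partial_deriv i (partial_deriv j k) p) \<le> 0"
proof -
  obtain r where r: "r > 0" "ball p r \<subseteq> S" "\<And>x. x \<in> ball p r \<Longrightarrow> k x \<le> k p" and "p \<in> S"
  proof -
    obtain r1 where r1: "r1 > 0" "\<forall>x\<in>S \<inter> ball p r1. k x \<le> k p" and p: "p \<in> S"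
      using assms(3) by (auto simp: local_max_in_def)
    obtain r2 where r2: "r2 > 0" "ball p r2 \<subseteq> S" using assms(1) p open_contains_ball by blast
    show ?thesis by (rule that[of "min r1 r2"]) (use r1 r2 p in auto)
  qed
  have diff: "k differentiable (at x)" "partial_deriv j k differentiable (at x)"
    if "x \<in> S" for x j using assms(2) that by (auto simp: C2_on_def C1_on_def)
  have D: "(k has_derivative frechet_derivative k (at x)) (at x)"
    "(partial_deriv j k has_derivative frechet_derivative (partial_deriv j k) (at x)) (at x)"
    if "x \<in> S" for x j using diff[OF that] frechet_derivative_works by blast+
  have "frechet_derivative k (at p) = (\<lambda>v. 0)"
    using r differential_zero_maxmin[OF _ _ D(1)[OF \<open>p \<in> S\<close>], of "ball p r"] by auto
  then show zero: "partial_deriv i k p = 0" for i by (simp add: partial_deriv_def)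
  define l where "l t = p + t *\<^sub>R \<xi>" for t
  define m where "m t = (\<Sum>j\<in>UNIV. \<xi> $ j * partial_deriv j k (l t))" for t
  define q where "q = (\<Sum>j\<in>UNIV. \<Sum>i\<in>UNIV. \<xi> $ i * \<xi> $ j * partial_deriv i (partial_deriv j k) p)"
  have lD: "(l has_derivative (\<lambda>s. s *\<^sub>R \<xi>)) (at t)" for t
    unfolding l_def by (auto intro!: derivative_eq_intros)
  have kD: "((\<lambda>t. k (l t)) has_real_derivative m t) (at t)" if "l t \<in> S" for t
  proof -
    have "((\<lambda>t. k (l t)) has_derivative (\<lambda>s. frechet_derivative k (at (l t)) (s *\<^sub>R \<xi>))) (at t)"
      using has_derivative_compose[OF lD D(1)[OF that]] .
    moreover have "(\<lambda>s. frechet_derivative k (at (l t)) (s *\<^sub>R \<xi>)) = (*) (m t)"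
      using linear_cmul[OF linear_frechet_derivative[OF diff(1)[OF that]]]
      by (auto simp: frechet_derivative_eq_sum_partial[OF diff(1)[OF that]] m_def)
    ultimately show ?thesis by (simp add: has_field_derivative_def)
  qed
  have mD: "(m has_real_derivative q) (at 0)"
  proof -
    have 0: "l 0 = p" by (simp add: l_def)
    have pj: "((\<lambda>t. partial_deriv j k (l t)) has_real_derivative
        (\<Sum>i\<in>UNIV. \<xi> $ i * partial_deriv i (partial_deriv j k) p)) (at 0)" for j
    proof -
      have "((\<lambda>t. partial_deriv j k (l t)) has_derivative
          (\<lambda>s. frechet_derivative (partial_deriv j k) (at p) (s *\<^sub>R \<xi>))) (at 0)"
        using has_derivative_compose[OF lD[of 0], of "partial_deriv j k"] D(2)[OF \<open>p \<in> S\<close>] 0 by simp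
      moreover have "(\<lambda>s. frechet_derivative (partial_deriv j k) (at p) (s *\<^sub>R \<xi>))
          = (*) (\<Sum>i\<in>UNIV. \<xi> $ i * partial_deriv i (partial_deriv j k) p)"
        using linear_cmul[OF linear_frechet_derivative[OF diff(2)[OF \<open>p \<in> S\<close>]]]
        by (auto simp: frechet_derivative_eq_sum_partial[OF diff(2)[OF \<open>p \<in> S\<close>]])
      ultimately show ?thesis by (simp add: has_field_derivative_def)
    qed
    have "(m has_real_derivative
        (\<Sum>j\<in>UNIV. \<xi> $ j * (\<Sum>i\<in>UNIV. \<xi> $ i * partial_deriv i (partial_deriv j k) p))) (at 0)"
      unfolding m_def by (intro DERIV_sum DERIV_cmult pj)
    then show ?thesis by (simp add: q_def sum_distrib_left mult_ac)
  qed
  have "q \<le> 0"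
  proof (rule ccontr)
    assume "\<not> q \<le> 0"
    then obtain d where d: "d > 0" "\<And>h. h > 0 \<Longrightarrow> h < d \<Longrightarrow> m 0 < m h"
      using DERIV_pos_inc_right[OF mD] by auto
    have m0: "m 0 = 0" by (simp add: m_def l_def zero)
    define e where "e = min (d/2) (r / (norm \<xi> + 1))"
    have e: "e > 0" "e < d" using d r by (auto simp: e_def min_less_iff_disj add_nonneg_pos)
    have inball: "l t \<in> ball p r" if "0 \<le> t" "t \<le> e" for t
    proof -
      have "t \<le> r / (norm \<xi> + 1)" using that by (simp add: e_def)
      then have "t * norm \<xi> + t \<le> r"
        using norm_ge_zero[of \<xi>] by (simp add: field_simps add_nonneg_pos pos_le_divide_eq)
      then have "t * norm \<xi> < r" using that r(1) by (cases "t = 0") auto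
      then show ?thesis using that by (simp add: l_def dist_norm)
    qed
    have "k (l 0) < k (l e)"
    proof (rule DERIV_pos_imp_increasing_open[OF e(1)])
      fix t assume t: "0 < t" "t < e"
      show "\<exists>y. ((\<lambda>t. k (l t)) has_real_derivative y) (at t) \<and> 0 < y"
        using kD[of t] inball[of t] r(2) t e(2) d(2)[of t] m0 by (intro exI[of _ "m t"]) auto
    next
      show "continuous_on {0..e} (\<lambda>t. k (l t))"
        using DERIV_isCont[OF kD] inball r(2) by (intro continuous_at_imp_continuous_on ballI) fastforce
    qed
    moreover have "k (l e) \<le> k p" using r(3) inball[of e] e by auto
    ultimately show False by (simp add: l_def)
  qed
  then show "(\<Sum>j\<in>UNIV. \<Sum>i\<in>UNIV. \<xi> $ i * \<xi> $ j * partial_deriv i (partial_deriv j k) p) \<le> 0"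
    by (simp add: q_def)
qed

text \<open>
  At a maximum of \<open>f - g\<close> both functions have the same gradient \<open>\<xi>\<close>, so the difference of the two
  infinity-Laplacians is the Hessian of \<open>f - g\<close> evaluated on \<open>\<xi>\<close>. This is what makes a classical
  subsolution a viscosity subsolution.
\<close>

lemma inf_laplacian_mono_at_local_max:
  assumes "open S" "C2_on S f" "C2_on S g" "local_max_in S (\<lambda>x. f x - g x) p"
  shows "inf_laplacian f p \<le> inf_laplacian g p"
proof -
  have p: "p \<in> S" using assms(4) by (simp add: local_max_in_def)
  let ?k = "\<lambda>x. 1 * f x + (-1) * g x"
  have k: "C2_on S ?k" "local_max_in S ?k p"
    using C2_on_lincomb[OF assms(1-3), of 1 "-1"] assms(4) by simp_all
  have d1: "partial_deriv i f p = partial_deriv i g p" for i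
    using local_max_second_order(1)[OF assms(1) k, of i] partial_deriv_lincomb[of f p g i 1 "-1"]
      assms(2,3) p by (simp add: C2_on_def C1_on_def)
  have d2: "partial_deriv i (partial_deriv j (\<lambda>x. f x - g x)) p
      = partial_deriv i (partial_deriv j f) p - partial_deriv i (partial_deriv j g) p" for i j
    using partial_deriv2_lincomb[OF assms(1-3) p, of i j 1 "-1"] by simp
  define \<xi> where "\<xi> = (\<chi> i. partial_deriv i g p)"
  have "inf_laplacian f p - inf_laplacian g p
      = (\<Sum>i\<in>UNIV. \<Sum>j\<in>UNIV. \<xi> $ i * \<xi> $ j * partial_deriv i (partial_deriv j ?k) p)"
    by (simp add: inf_laplacian_def d1 d2 \<xi>_def sum_subtractf right_diff_distrib del: mult_minus_left)
  also have "\<dots> = (\<Sum>j\<in>UNIV. \<Sum>i\<in>UNIV. \<xi> $ i * \<xi> $ j * partial_deriv i (partial_deriv j ?k) p)"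
    by (rule sum.swap)
  also have "\<dots> \<le> 0" by (rule local_max_second_order(2)[OF assms(1) k])
  finally show ?thesis by simp
qed

section \<open>Radial test functions and cones\<close>

lemma norm_square_has_derivative:
  fixes y :: "'a::real_inner"
  shows "((\<lambda>x. (norm (x - y))\<^sup>2) has_derivative (\<lambda>v. 2 * ((x - y) \<bullet> v))) (at x)"
  unfolding power2_norm_eq_inner
  by (auto intro!: derivative_eq_intros simp: inner_commute)

lemma poly_norm_square_has_derivative:
  fixes y :: "'a::real_inner"
  shows "((\<lambda>x. poly P ((norm (x - y))\<^sup>2)) has_derivative
    (\<lambda>v. 2 * poly (pderiv P) ((norm (x - y))\<^sup>2) * ((x - y) \<bullet> v))) (at x)"
proof -
  have "(poly P has_derivative (*) (poly (pderiv P) ((norm (x - y))\<^sup>2))) (at ((norm (x - y))\<^sup>2))"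
    using poly_DERIV has_field_derivative_def by blast
  from has_derivative_compose[OF norm_square_has_derivative this]
  show ?thesis by (simp add: mult_ac)
qed

lemma partial_deriv_radial:
  "partial_deriv j (\<lambda>x. poly P ((norm (x - y))\<^sup>2)) x
    = 2 * poly (pderiv P) ((norm (x - y))\<^sup>2) * (x - y) $ j"
  by (subst partial_deriv_eq[OF poly_norm_square_has_derivative]) (simp add: inner_axis)

lemma partial_deriv_radial_has_derivative:
  fixes y :: "real ^ 'n::finite"
  shows "(partial_deriv j (\<lambda>x. poly P ((norm (x - y))\<^sup>2)) has_derivative
    (\<lambda>v. 4 * poly (pderiv (pderiv P)) ((norm (x - y))\<^sup>2) * ((x - y) \<bullet> v) * (x - y) $ j
      + 2 * poly (pderiv P) ((norm (x - y))\<^sup>2) * v $ j)) (at x)"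
proof -
  have *: "((\<lambda>x. (x - y) $ j) has_derivative (\<lambda>v. v $ j)) (at x)"
    by (auto intro!: derivative_eq_intros bounded_linear.has_derivative[OF bounded_linear_vec_nth])
  have "((\<lambda>x. 2 * poly (pderiv P) ((norm (x - y))\<^sup>2) * (x - y) $ j) has_derivative
    (\<lambda>v. 2 * poly (pderiv P) ((norm (x - y))\<^sup>2) * v $ j
      + 2 * (2 * poly (pderiv (pderiv P)) ((norm (x - y))\<^sup>2) * ((x - y) \<bullet> v)) * (x - y) $ j)) (at x)"
    by (intro has_derivative_mult has_derivative_mult_right poly_norm_square_has_derivative *)
  then show ?thesis
    unfolding partial_deriv_radial[abs_def] by (simp add: mult_ac add_ac)
qed

lemma partial_deriv2_radial:
  "partial_deriv i (partial_deriv j (\<lambda>x. poly P ((norm (x - y))\<^sup>2))) x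
    = 4 * poly (pderiv (pderiv P)) ((norm (x - y))\<^sup>2) * (x - y) $ i * (x - y) $ j
      + (if i = j then 2 * poly (pderiv P) ((norm (x - y))\<^sup>2) else 0)"
  by (subst partial_deriv_eq[OF partial_deriv_radial_has_derivative])
     (simp add: inner_axis, simp add: axis_def)

lemma C2_on_radial:
  fixes y :: "real ^ 'n::finite"
  shows "C2_on S (\<lambda>x. poly P ((norm (x - y))\<^sup>2))"
proof -
  have "continuous_on S (partial_deriv i (\<lambda>x. poly P ((norm (x - y))\<^sup>2)))" for i
    unfolding partial_deriv_radial[abs_def] by (intro continuous_intros)
  moreover have "continuous_on S (\<lambda>x. partial_deriv i (partial_deriv j (\<lambda>x. poly P ((norm (x - y))\<^sup>2))) x)" for i j
    unfolding partial_deriv2_radial by (cases "i = j") (simp_all, (intro continuous_intros)+)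
  ultimately show ?thesis
    using poly_norm_square_has_derivative[of P y] partial_deriv_radial_has_derivative[of _ P y]
    by (fastforce simp: C2_on_def C1_on_def differentiable_def)
qed

text \<open>
  Test functions are taken to be polynomials in the squared distance, because these are smooth also
  at the centre.
\<close>

lemma inf_laplacian_radial:
  fixes x y :: "real ^ 'n::finite"
  defines "s \<equiv> (norm (x - y))\<^sup>2"
  shows "inf_laplacian (\<lambda>x. poly P ((norm (x - y))\<^sup>2)) x
    = 8 * (poly (pderiv P) s)\<^sup>2 * s * (poly (pderiv P) s + 2 * poly (pderiv (pderiv P)) s * s)"
proof -
  define z where "z = x - y"
  define p1 p2 where "p1 = poly (pderiv P) s" and "p2 = poly (pderiv (pderiv P)) s"
  have s: "s = (\<Sum>i\<in>UNIV. z $ i * z $ i)"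
    by (simp add: s_def z_def power2_norm_eq_inner inner_vec_def)
  have "inf_laplacian (\<lambda>x. poly P ((norm (x - y))\<^sup>2)) x
      = (\<Sum>i\<in>UNIV. \<Sum>j\<in>UNIV. (2 * p1 * z $ i) * (2 * p1 * z $ j) * (4 * p2 * z $ i * z $ j
          + (if i = j then 2 * p1 else 0)))"
    unfolding inf_laplacian_def partial_deriv2_radial unfolding partial_deriv_radial
    unfolding p1_def p2_def z_def s_def by (simp only: mult.assoc)
  also have "\<dots> = (\<Sum>i\<in>UNIV. \<Sum>j\<in>UNIV. 16 * p1\<^sup>2 * p2 * ((z $ i * z $ i) * (z $ j * z $ j))
          + (if i = j then 8 * p1 ^ 3 * (z $ i * z $ j) else 0))"
    by (intro sum.cong refl) (simp add: algebra_simps power2_eq_square power3_eq_cube)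
  also have "\<dots> = 16 * p1\<^sup>2 * p2 * (s * s) + 8 * p1 ^ 3 * s"
  proof -
    have "(\<Sum>i\<in>UNIV. \<Sum>j\<in>UNIV. 16 * p1\<^sup>2 * p2 * ((z $ i * z $ i) * (z $ j * z $ j))) = 16 * p1\<^sup>2 * p2 * (s * s)"
      unfolding s unfolding sum_product unfolding sum_distrib_left ..
    moreover have "(\<Sum>i\<in>UNIV. \<Sum>j\<in>UNIV. if i = j then 8 * p1 ^ 3 * (z $ i * z $ j) else 0) = 8 * p1 ^ 3 * s"
      by (simp add: s sum_distrib_left)
    ultimately show ?thesis by (simp only: sum.distrib)
  qed
  finally show ?thesis
    by (simp add: p1_def p2_def algebra_simps power2_eq_square power3_eq_cube)
qed

text \<open>
  Adding a multiple of \<open>norm (x - q) ^ 4\<close> turns a local extremum at \<open>q\<close> into a quantitatively strict one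
  without changing any derivative at \<open>q\<close> up to order two.
\<close>

lemma quartic_perturbation:
  fixes q :: "real ^ 'n::finite"
  assumes "open S" "C2_on S \<psi>" "q \<in> S"
  shows "C2_on S (\<lambda>x. \<psi> x + \<beta> * norm (x - q) ^ 4)"
    and "inf_laplacian (\<lambda>x. \<psi> x + \<beta> * norm (x - q) ^ 4) q = inf_laplacian \<psi> q"
proof -
  define g where "g = (\<lambda>x. poly [:0, 0, 1::real:] ((norm (x - q))\<^sup>2))"
  have g: "(\<lambda>x. \<psi> x + \<beta> * norm (x - q) ^ 4) = (\<lambda>x. 1 * \<psi> x + \<beta> * g x)"
    by (simp add: g_def flip: power_mult power_add)
  have C2: "C2_on S g" unfolding g_def by (rule C2_on_radial)
  show "C2_on S (\<lambda>x. \<psi> x + \<beta> * norm (x - q) ^ 4)"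
    unfolding g by (rule C2_on_lincomb[OF assms(1,2) C2])
  have "partial_deriv i g q = 0" "partial_deriv i (partial_deriv j g) q = 0" for i j
    unfolding g_def partial_deriv2_radial unfolding partial_deriv_radial
    by (auto simp: pderiv_pCons)
  moreover have "\<psi> differentiable (at q)" "g differentiable (at q)"
    using assms C2 by (auto simp: C2_on_def C1_on_def)
  ultimately show "inf_laplacian (\<lambda>x. \<psi> x + \<beta> * norm (x - q) ^ 4) q = inf_laplacian \<psi> q"
    unfolding g inf_laplacian_def
    by (simp only: partial_deriv2_lincomb[OF assms(1,2) C2 assms(3)] partial_deriv_lincomb) simp
qed

text \<open>
  For \<open>r \<ge> 0\<close> the right-hand side is the third-order Taylor polynomial at \<open>d\<^sup>2\<close> of the square root,
  evaluated at \<open>r\<^sup>2\<close>. It lies above the square root; after scaling to \<open>d = 1\<close> the difference is an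
  explicit product of nonnegative factors.
\<close>

lemma le_sextic:
  fixes r d :: real
  assumes "d > 0"
  shows "r \<le> (5 * d + 15 * r\<^sup>2 / d - 5 * (r\<^sup>2)\<^sup>2 / d ^ 3 + (r\<^sup>2) ^ 3 / d ^ 5) / 16"
proof -
  define x where "x = r / d"
  have r: "r = d * x" using assms by (simp add: x_def)
  have "5 + 15 * x\<^sup>2 - 5 * x ^ 4 + x ^ 6 - 16 * x = (x - 1) ^ 4 * ((x + 2)\<^sup>2 + 1)"
    by (simp add: algebra_simps power2_eq_square eval_nat_numeral)
  then have "0 \<le> d * (5 + 15 * x\<^sup>2 - 5 * x ^ 4 + x ^ 6 - 16 * x)"
    using assms by simp
  also have "\<dots> = 16 * ((5 * d + 15 * r\<^sup>2 / d - 5 * (r\<^sup>2)\<^sup>2 / d ^ 3 + (r\<^sup>2) ^ 3 / d ^ 5) / 16 - r)"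
    using assms by (simp add: r field_simps power2_eq_square eval_nat_numeral)
  finally show ?thesis by simp
qed

text \<open>
  The concave cone \<open>K r - C r\<^sup>2\<close> with \<open>r = norm (x - y)\<close> has infinity-Laplacian \<open>g'\<^sup>2 g'' = - 2 C (K - 2 C r)\<^sup>2\<close>
  away from its vertex \<open>y\<close>, but it is not differentiable at \<open>y\<close>, hence it is no admissible test function
  on a domain containing \<open>y\<close>. At any other point \<open>p\<close> it can be replaced by a globally smooth function
  that lies above it, touches it at \<open>p\<close>, and has the same second-order behaviour there: the square root
  of the squared distance is replaced by the Taylor polynomial of \<open>le_sextic\<close>.
\<close>

lemma cone_touched_from_above:
  fixes p y :: "real ^ 'n::finite" and K C :: real
  assumes "p \<noteq> y" "0 \<le> K"
  obtains \<psi> where "\<And>S. C2_on S \<psi>"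
    and "\<And>x. K * norm (x - y) - C * (norm (x - y))\<^sup>2 \<le> \<psi> x"
    and "\<psi> p = K * norm (p - y) - C * (norm (p - y))\<^sup>2"
    and "inf_laplacian \<psi> p = - 2 * C * (K - 2 * C * norm (p - y))\<^sup>2"
proof -
  define d where "d = norm (p - y)"
  have d: "d > 0" using assms by (simp add: d_def)
  define P where "P = [: 5 * d * K / 16, 15 * K / (16 * d) - C, - 5 * K / (16 * d ^ 3), K / (16 * d ^ 5) :]"
  have P: "poly P (r\<^sup>2)
      = K * ((5 * d + 15 * r\<^sup>2 / d - 5 * (r\<^sup>2)\<^sup>2 / d ^ 3 + (r\<^sup>2) ^ 3 / d ^ 5) / 16) - C * r\<^sup>2" for r
    using d by (simp add: P_def field_simps power2_eq_square eval_nat_numeral)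
  have P1: "poly (pderiv P) (d\<^sup>2) = K / (2 * d) - C"
    using d by (simp add: P_def pderiv_pCons field_simps power2_eq_square eval_nat_numeral)
  have P2: "poly (pderiv (pderiv P)) (d\<^sup>2) = - K / (4 * d ^ 3)"
    using d by (simp add: P_def pderiv_pCons field_simps power2_eq_square eval_nat_numeral)
  show thesis
  proof (rule that[of "\<lambda>x. poly P ((norm (x - y))\<^sup>2)"])
    show "C2_on S (\<lambda>x. poly P ((norm (x - y))\<^sup>2))" for S by (rule C2_on_radial)
    show "K * norm (x - y) - C * (norm (x - y))\<^sup>2 \<le> poly P ((norm (x - y))\<^sup>2)" for x
      unfolding P using mult_left_mono[OF le_sextic[OF d] assms(2)] by (rule diff_right_mono)
    show "poly P ((norm (p - y))\<^sup>2) = K * norm (p - y) - C * (norm (p - y))\<^sup>2"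
      unfolding P d_def[symmetric] using d by (simp add: field_simps power2_eq_square eval_nat_numeral)
    show "inf_laplacian (\<lambda>x. poly P ((norm (x - y))\<^sup>2)) p = - 2 * C * (K - 2 * C * norm (p - y))\<^sup>2"
      unfolding inf_laplacian_radial d_def[symmetric] P1 P2
      using d by (simp add: field_simps power2_eq_square eval_nat_numeral)
  qed
qed

lemma no_local_max_against_cone:
  fixes p y :: "real ^ 'n::finite"
  assumes "visc_ge S F w" "- C \<le> F p (w p)" "0 < C" "p \<noteq> y" "1 \<le> K - 2 * C * norm (p - y)"
  shows "\<not> local_max_in S (\<lambda>x. w x - (K * norm (x - y) - C * (norm (x - y))\<^sup>2)) p"
proof
  assume max: "local_max_in S (\<lambda>x. w x - (K * norm (x - y) - C * (norm (x - y))\<^sup>2)) p"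
  have "0 \<le> C * norm (p - y)" using assms by simp
  then have "0 \<le> K" using assms by linarith
  obtain \<psi> where \<psi>: "C2_on S \<psi>" "\<And>x. K * norm (x - y) - C * (norm (x - y))\<^sup>2 \<le> \<psi> x"
    "\<psi> p = K * norm (p - y) - C * (norm (p - y))\<^sup>2"
    "inf_laplacian \<psi> p = - 2 * C * (K - 2 * C * norm (p - y))\<^sup>2"
    by (rule cone_touched_from_above[OF \<open>p \<noteq> y\<close> \<open>0 \<le> K\<close>, of C]) blast
  have "local_max_in S (\<lambda>x. w x - \<psi> x) p"
    using max \<psi>(2,3) unfolding local_max_in_def by (smt (verit))
  then have "F p (w p) \<le> inf_laplacian \<psi> p"
    using assms(1) \<psi>(1) unfolding visc_ge_def by blast
  moreover have "1 \<le> (K - 2 * C * norm (p - y))\<^sup>2"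
    using assms(5) by (simp add: one_le_power)
  then have "C * 1 \<le> C * (K - 2 * C * norm (p - y))\<^sup>2"
    using assms(3) by (intro mult_left_mono) auto
  ultimately show False using assms(2,3) \<psi>(4) by simp
qed

lemma inverted_cone_subsolution:
  fixes p y :: "real ^ 'n::finite"
  assumes "open S" "C2_on S \<psi>" "0 < C" "p \<noteq> y" "1 \<le> K - 2 * C * norm (p - y)"
    and max: "local_max_in S (\<lambda>x. c - (K * norm (x - y) - C * (norm (x - y))\<^sup>2) - \<psi> x) p"
  shows "C \<le> inf_laplacian \<psi> p"
proof -
  have "0 \<le> C * norm (p - y)" using assms by simp
  then have "0 \<le> K" using assms by linarith
  obtain \<phi> where \<phi>: "C2_on S \<phi>" "\<And>x. K * norm (x - y) - C * (norm (x - y))\<^sup>2 \<le> \<phi> x"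
    "\<phi> p = K * norm (p - y) - C * (norm (p - y))\<^sup>2"
    "inf_laplacian \<phi> p = - 2 * C * (K - 2 * C * norm (p - y))\<^sup>2"
    by (rule cone_touched_from_above[OF \<open>p \<noteq> y\<close> \<open>0 \<le> K\<close>, of C]) blast
  have p: "p \<in> S" using max by (simp add: local_max_in_def)
  have "local_max_in S (\<lambda>x. -1 * \<phi> x - \<psi> x) p"
    using max \<phi>(2,3) unfolding local_max_in_def by (smt (verit))
  then have "inf_laplacian (\<lambda>x. -1 * \<phi> x) p \<le> inf_laplacian \<psi> p"
    by (intro inf_laplacian_mono_at_local_max[OF assms(1) inf_laplacian_scale(1)[OF assms(1) \<phi>(1) p] assms(2)])
  then have "2 * C * (K - 2 * C * norm (p - y))\<^sup>2 \<le> inf_laplacian \<psi> p"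
    by (simp only: inf_laplacian_scale(2)[OF assms(1) \<phi>(1) p] \<phi>(4)) simp
  moreover have "1 \<le> (K - 2 * C * norm (p - y))\<^sup>2"
    using assms(5) by (simp add: one_le_power)
  then have "C * 1 \<le> C * (K - 2 * C * norm (p - y))\<^sup>2"
    using assms(3) by (intro mult_left_mono) auto
  ultimately show ?thesis using assms(3) by linarith
qed

section \<open>Viscosity subsolutions\<close>

text \<open>
  Comparison with cones from above. The maximum of \<open>w\<close> minus the cone over \<open>N\<close> cannot lie in \<open>T\<close>, because
  the cone is too concave there. Two choices matter later: \<open>T\<close> a punctured ball, which gives Lipschitz
  bounds, and \<open>T\<close> the whole domain with the vertex on its boundary, which gives boundary barriers.
\<close>

lemma cone_comparison:
  fixes w :: "real ^ 'n::finite \<Rightarrow> real"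
  assumes T: "open T" "T \<subseteq> S" "T \<subseteq> N" and N: "compact N" "continuous_on N w"
    and w: "visc_ge S F w" "\<And>x. x \<in> T \<Longrightarrow> - C \<le> F x (w x)" and C: "0 < C"
    and y: "y \<notin> T" "\<And>x. x \<in> T \<Longrightarrow> 1 \<le> K - 2 * C * norm (x - y)"
    and bd: "\<And>x. x \<in> N - T \<Longrightarrow> w x \<le> c + (K * norm (x - y) - C * (norm (x - y))\<^sup>2)"
    and x: "x \<in> N"
  shows "w x \<le> c + (K * norm (x - y) - C * (norm (x - y))\<^sup>2)"
proof -
  let ?e = "\<lambda>x. w x - (K * norm (x - y) - C * (norm (x - y))\<^sup>2)"
  have "continuous_on N ?e" by (intro continuous_intros N)
  then obtain p where p: "p \<in> N" "\<And>x. x \<in> N \<Longrightarrow> ?e x \<le> ?e p"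
    using continuous_attains_sup[of N ?e] N x by blast
  have "p \<notin> T"
  proof
    assume pT: "p \<in> T"
    then obtain r where r: "r > 0" "ball p r \<subseteq> T" using T(1) open_contains_ball by blast
    have "local_max_in S ?e p"
      unfolding local_max_in_def using pT T r p(2) by (intro conjI exI[of _ r]) blast+
    moreover have "p \<noteq> y" using pT y(1) by blast
    ultimately show False
      using no_local_max_against_cone[OF w(1) w(2)[OF pT] C _ y(2)[OF pT]] by blast
  qed
  then have "?e p \<le> c" using bd[of p] p(1) by simp
  then show ?thesis using p(2)[OF x] by simp
qed

text \<open>
  A pointwise version of the subsolution property, needed because the functions constructed below are
  pieced together from several functions and are treated point by point.
\<close>

definition visc_ge_at ::
  "(real ^ 'n::finite) set \<Rightarrow> (real ^ 'n \<Rightarrow> real \<Rightarrow> real) \<Rightarrow> (real ^ 'n \<Rightarrow> real) \<Rightarrow> real ^ 'n \<Rightarrow> bool" where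
  "visc_ge_at S F u p \<longleftrightarrow>
     (\<forall>\<psi>. C2_on S \<psi> \<longrightarrow> local_max_in S (\<lambda>x. u x - \<psi> x) p \<longrightarrow> F p (u p) \<le> inf_laplacian \<psi> p)"

lemma visc_ge_iff_at:
  "visc_ge S F u \<longleftrightarrow> continuous_on S u \<and> (\<forall>p\<in>S. visc_ge_at S F u p)"
  by (auto simp: visc_ge_def visc_ge_at_def local_max_in_def)

lemma visc_ge_at_touched_from_below:
  assumes "visc_ge_at S F u p" "r > 0" "\<And>x. x \<in> S \<inter> ball p r \<Longrightarrow> u x \<le> U x" "U p = u p"
  shows "visc_ge_at S F U p"
proof -
  have "local_max_in S (\<lambda>x. u x - \<psi> x) p" if max: "local_max_in S (\<lambda>x. U x - \<psi> x) p" for \<psi>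
  proof -
    obtain d where "p \<in> S" "d > 0" "\<forall>x\<in>S \<inter> ball p d. U x - \<psi> x \<le> U p - \<psi> p"
      using max by (auto simp: local_max_in_def)
    then have "u x - \<psi> x \<le> u p - \<psi> p" if "x \<in> S \<inter> ball p (min r d)" for x
    proof -
      have "U x - \<psi> x \<le> U p - \<psi> p" "u x \<le> U x"
        using that \<open>\<forall>x\<in>S \<inter> ball p d. U x - \<psi> x \<le> U p - \<psi> p\<close> assms(3)[of x] by auto
      then show ?thesis using assms(4) by linarith
    qed
    then show ?thesis unfolding local_max_in_def
      using \<open>p \<in> S\<close> \<open>d > 0\<close> assms(2) by (intro conjI exI[of _ "min r d"]) auto
  qed
  then show ?thesis using assms(1,4) by (auto simp: visc_ge_at_def)
qed

lemma positive_nearby: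
  fixes G :: "'a::metric_space \<Rightarrow> real \<Rightarrow> real"
  assumes "open S" "continuous_on (S \<times> UNIV) (\<lambda>(x, t). G x t)" "p \<in> S" "0 < G p t0"
  obtains r where "r > 0" "ball p r \<subseteq> S" "\<And>x t. x \<in> ball p r \<Longrightarrow> \<bar>t - t0\<bar> < r \<Longrightarrow> 0 < G x t"
proof -
  have "open {xt \<in> S \<times> UNIV. (\<lambda>(x, t). G x t) xt \<in> {0<..}}"
    by (rule continuous_open_preimage[OF assms(2), unfolded vimage_def Collect_conj_eq[symmetric] , simplified Int_def mem_Collect_eq])
       (auto intro: open_Times assms)
  then obtain A B where A: "open A" "open B" "(p, t0) \<in> A \<times> B"
    "A \<times> B \<subseteq> {xt \<in> S \<times> UNIV. (\<lambda>(x, t). G x t) xt \<in> {0<..}}"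
    by (rule open_prod_elim) (use assms in auto)
  obtain r1 where r1: "r1 > 0" "ball p r1 \<subseteq> A" using A open_contains_ball by blast
  obtain r2 where r2: "r2 > 0" "ball t0 r2 \<subseteq> B" using A open_contains_ball by blast
  show thesis
  proof (rule that[of "min r1 r2"])
    fix x t assume x: "x \<in> ball p (min r1 r2)" and t: "\<bar>t - t0\<bar> < min r1 r2"
    have "t \<in> B" using t r2 by (auto simp: dist_real_def abs_minus_commute subset_eq)
    moreover have "x \<in> A" using x r1 by auto
    ultimately have "(x, t) \<in> A \<times> B" by blast
    then show "0 < G x t" using subsetD[OF A(4)] by auto
  next
    have "A \<subseteq> S" using A(3,4) by auto
    then show "ball p (min r1 r2) \<subseteq> S" using r1 by auto
  qed (use r1 r2 in auto)
qed

lemma near_value: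
  assumes "open S" "continuous_on S (f :: 'a::metric_space \<Rightarrow> real)" "p \<in> S" "e > 0"
  obtains d where "d > 0" "\<And>x. x \<in> ball p d \<Longrightarrow> \<bar>f x - f p\<bar> < e"
proof -
  have "isCont f p" using assms continuous_on_eq_continuous_at by blast
  then show thesis
    using that assms(4) by (auto simp: continuous_at_eps_delta dist_real_def dist_commute)
qed

section \<open>Perron envelope between a sub- and a supersolution\<close>

text \<open>
  The Dirichlet problem with an ordered pair \<open>W \<le> V\<close> of a sub- and a supersolution, whose values also
  enclose the boundary data. The constant \<open>C\<close> bounds \<open>F x t\<close> for the values \<open>t\<close> between \<open>- M\<close> and \<open>M\<close> that can
  occur between \<open>W\<close> and \<open>V\<close>, so that all functions involved are compared with the cones of curvature \<open>C\<close>.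
\<close>

locale perron =
  fixes \<Omega> :: "(real ^ 'n::finite) set" and F :: "real ^ 'n \<Rightarrow> real \<Rightarrow> real"
    and W V b :: "real ^ 'n \<Rightarrow> real" and M C D :: real
  assumes domain: "open \<Omega>" "bounded \<Omega>"
    and diameter: "0 < D" "\<And>x y. x \<in> closure \<Omega> \<Longrightarrow> y \<in> closure \<Omega> \<Longrightarrow> norm (x - y) \<le> D"
    and F: "continuous_on (\<Omega> \<times> UNIV) (\<lambda>(x, t). F x t)"
    and F_bound: "0 < C" "\<And>x t. x \<in> \<Omega> \<Longrightarrow> \<bar>t\<bar> \<le> M \<Longrightarrow> \<bar>F x t\<bar> \<le> C"
    and W: "visc_ge \<Omega> F W" "continuous_on (closure \<Omega>) W"
    and V: "visc_le \<Omega> F V"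
    and W_le_V: "\<And>x. x \<in> \<Omega> \<Longrightarrow> W x \<le> V x"
    and bounds: "\<And>x. x \<in> \<Omega> \<Longrightarrow> - M \<le> W x" "\<And>x. x \<in> \<Omega> \<Longrightarrow> V x \<le> M"
      "\<And>z. z \<in> frontier \<Omega> \<Longrightarrow> \<bar>b z\<bar> \<le> M"
    and b: "continuous_on (frontier \<Omega>) b"
    and separation: "\<And>x z. x \<in> closure \<Omega> \<Longrightarrow> z \<in> frontier \<Omega> \<Longrightarrow> W x \<le> b z"
      "\<And>x z. x \<in> \<Omega> \<Longrightarrow> z \<in> frontier \<Omega> \<Longrightarrow> b z \<le> V x"
begin

definition subs :: "(real ^ 'n \<Rightarrow> real) set" where
  "subs = {w. continuous_on (closure \<Omega>) w \<and> visc_ge \<Omega> F w \<and>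
     (\<forall>x\<in>\<Omega>. W x \<le> w x \<and> w x \<le> V x) \<and> (\<forall>z\<in>frontier \<Omega>. w z \<le> b z)}"

definition envelope :: "real ^ 'n \<Rightarrow> real" where
  "envelope x = (if x \<in> \<Omega> then SUP w\<in>subs. w x else b x)"

lemma frontier_eq: "frontier \<Omega> = closure \<Omega> - \<Omega>"
  using domain(1) by (simp add: frontier_def interior_open)

lemma W_in_subs: "W \<in> subs"
proof -
  have "W z \<le> b z" if "z \<in> frontier \<Omega>" for z using separation(1)[OF _ that] that frontier_eq by auto
  then show ?thesis using W W_le_V by (auto simp: subs_def)
qed

lemma subs_bound: "w \<in> subs \<Longrightarrow> x \<in> \<Omega> \<Longrightarrow> \<bar>w x\<bar> \<le> M"
  using bounds(1,2)[of x] by (fastforce simp: subs_def abs_le_iff)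

lemma subs_F_bound: "w \<in> subs \<Longrightarrow> x \<in> \<Omega> \<Longrightarrow> - C \<le> F x (w x)"
  using F_bound(2)[OF _ subs_bound] by (fastforce simp: abs_le_iff)

lemma subs_bdd_above: "x \<in> \<Omega> \<Longrightarrow> bdd_above ((\<lambda>w. w x) ` subs)"
  by (rule bdd_aboveI[of _ "V x"]) (auto simp: subs_def)

lemma subs_le_envelope: "w \<in> subs \<Longrightarrow> x \<in> \<Omega> \<Longrightarrow> w x \<le> envelope x"
  using cSUP_upper[OF _ subs_bdd_above, of w x] by (simp add: envelope_def)

lemma envelope_le: "x \<in> \<Omega> \<Longrightarrow> (\<And>w. w \<in> subs \<Longrightarrow> w x \<le> c) \<Longrightarrow> envelope x \<le> c"
  using W_in_subs by (auto simp: envelope_def intro!: cSUP_least)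

lemma envelope_between: "x \<in> \<Omega> \<Longrightarrow> W x \<le> envelope x" "x \<in> \<Omega> \<Longrightarrow> envelope x \<le> V x"
  using subs_le_envelope[OF W_in_subs] envelope_le[of x "V x"] by (auto simp: subs_def)

lemma envelope_frontier: "z \<in> frontier \<Omega> \<Longrightarrow> envelope z = b z"
  by (simp add: envelope_def frontier_eq)

lemma envelope_approx:
  assumes "x \<in> \<Omega>" "e > 0"
  obtains w where "w \<in> subs" "envelope x - e < w x"
  using envelope_le[OF assms(1), of "envelope x - e"] assms(2) that by fastforce

text \<open>
  The slope of the comparison cone depends on \<open>r\<close> and the data but not on \<open>w\<close>. The term \<open>2 * M / r\<close> lifts the
  cone above \<open>w\<close> on the sphere of radius \<open>r\<close>; the term \<open>2 * C * D + 1\<close> keeps its slope at least one up to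
  distance \<open>D\<close>.
\<close>

lemma subs_locally_lipschitz:
  assumes w: "w \<in> subs" and r: "0 < r" "cball y r \<subseteq> \<Omega>" and x: "x \<in> cball y r"
  shows "w x \<le> w y + (2 * C * D + 1 + 2 * M / r) * norm (x - y)"
proof -
  define K where "K = 2 * C * D + 1 + 2 * M / r"
  have yO: "y \<in> \<Omega>" using r by auto
  have M: "0 \<le> M" using subs_bound[OF w yO] by linarith
  have small: "norm (x - y) \<le> D" if "x \<in> cball y r" for x
    using diameter(2)[of x y] that r(2) yO closure_subset by blast
  have "w x \<le> w y + (K * norm (x - y) - C * (norm (x - y))\<^sup>2)"
  proof (rule cone_comparison[where S = \<Omega> and T = "ball y r - {y}" and N = "cball y r" and F = F])
    show "continuous_on (cball y r) w"
      using w r(2) closure_subset by (auto simp: subs_def intro: continuous_on_subset)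
    show "visc_ge \<Omega> F w" using w by (simp add: subs_def)
    show "1 \<le> K - 2 * C * norm (x - y)" if "x \<in> ball y r - {y}" for x
    proof -
      have "C * norm (x - y) \<le> C * D" using small[of x] that F_bound(1) by (intro mult_left_mono) auto
      moreover have "0 \<le> 2 * M / r" using M r by simp
      ultimately show ?thesis by (simp add: K_def)
    qed
    show "w x \<le> w y + (K * norm (x - y) - C * (norm (x - y))\<^sup>2)"
      if x: "x \<in> cball y r - (ball y r - {y})" for x
    proof (cases "x = y")
      case False
      then have nr: "norm (x - y) = r" using x by (auto simp: dist_norm norm_minus_commute)
      have "C * (r * r) \<le> C * (D * r)"
        using small[of x] x nr r(1) F_bound(1) by (intro mult_left_mono mult_right_mono) auto
      moreover have "0 \<le> C * (D * r)" using F_bound(1) diameter(1) r(1) by simp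
      ultimately have "2 * M \<le> K * r - C * r\<^sup>2"
        using r(1) by (simp add: K_def distrib_right power2_eq_square mult.assoc)
      moreover have "w x \<le> M" "- M \<le> w y"
        using subs_bound[OF w, of x] subs_bound[OF w yO] x r(2) by (auto simp: abs_le_iff)
      ultimately show ?thesis by (simp add: nr)
    qed simp
    show "- C \<le> F x (w x)" if "x \<in> ball y r - {y}" for x
    proof (rule subs_F_bound[OF w])
      have "x \<in> cball y r" using that by simp
      then show "x \<in> \<Omega>" using r(2) by blast
    qed
    show "ball y r - {y} \<subseteq> \<Omega>" using r(2) ball_subset_cball[of y r] by blast
  qed (use x F_bound(1) in auto)
  moreover have "0 \<le> C * (norm (x - y))\<^sup>2" using F_bound(1) by simp
  ultimately show ?thesis by (simp add: K_def)
qed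

lemma continuous_on_envelope: "continuous_on \<Omega> envelope"
proof -
  have "isCont envelope y" if y: "y \<in> \<Omega>" for y
  proof -
    obtain r' where r': "r' > 0" "cball y r' \<subseteq> \<Omega>" using domain(1) y open_contains_cball by blast
    define r where "r = r' / 2"
    have r: "r > 0" "cball y (2 * r) \<subseteq> \<Omega>" using r' by (auto simp: r_def)
    define L where "L = 2 * C * D + 1 + 2 * M / r"
    have step: "envelope x \<le> envelope y + L * norm (x - y)" if xy: "cball y r \<subseteq> \<Omega>" "x \<in> cball y r" for x y
    proof (rule envelope_le)
      show "x \<in> \<Omega>" using xy by blast
      fix w assume w: "w \<in> subs"
      have "y \<in> \<Omega>" using xy r(1) by auto
      then show "w x \<le> envelope y + L * norm (x - y)"
        using subs_locally_lipschitz[OF w r(1) xy] subs_le_envelope[OF w, of y] by (simp add: L_def)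
    qed
    have "\<bar>envelope x - envelope y\<bar> \<le> L * norm (x - y)" if x: "x \<in> ball y r" for x
    proof -
      have "cball x r \<subseteq> cball y (2 * r)"
      proof
        fix z assume "z \<in> cball x r"
        then show "z \<in> cball y (2 * r)" using x dist_triangle[of y z x] by simp
      qed
      moreover have "cball y r \<subseteq> cball y (2 * r)" using r(1) by (auto)
      ultimately have "cball x r \<subseteq> \<Omega>" "cball y r \<subseteq> \<Omega>" using r(2) by blast+
      then show ?thesis using step[of y x] step[of x y] x by (simp add: dist_commute norm_minus_commute abs_le_iff)
    qed
    then have ev: "\<forall>\<^sub>F x in at y. norm (envelope x - envelope y) \<le> L * norm (x - y)"
      using r(1) by (auto simp: eventually_at dist_commute intro!: exI[of _ r])
    have "((\<lambda>x. L * norm (x - y)) \<longlongrightarrow> L * norm (y - y)) (at y)" by (intro tendsto_intros)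
    then have "((\<lambda>x. envelope x - envelope y) \<longlongrightarrow> 0) (at y)"
      by (intro Lim_null_comparison[OF ev]) simp
    then show ?thesis by (simp add: isCont_def LIM_zero_cancel)
  qed
  then show ?thesis by (simp add: continuous_at_imp_continuous_on)
qed

text \<open>
  The error \<open>e\<close> takes care of the boundary points close to \<open>z\<close>, by continuity of \<open>b\<close>, and a steep slope of
  those further away.
\<close>

lemma boundary_cone:
  assumes z: "z \<in> frontier \<Omega>" and e: "e > 0"
  obtains K where "2 * C * D + 1 \<le> K"
    "\<And>x. x \<in> frontier \<Omega> \<Longrightarrow> \<bar>b x - b z\<bar> \<le> e + (K * norm (x - z) - C * (norm (x - z))\<^sup>2)"
proof -
  have M: "0 \<le> M" using bounds(3)[OF z] by linarith
  obtain r where r: "r > 0" "\<And>x. x \<in> frontier \<Omega> \<Longrightarrow> dist x z < r \<Longrightarrow> \<bar>b x - b z\<bar> < e"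
    using b z e unfolding continuous_on_iff dist_real_def by blast
  define K where "K = 2 * C * D + 1 + 2 * M / r"
  show thesis
  proof (rule that[of K])
    show "2 * C * D + 1 \<le> K" using M r(1) by (simp add: K_def)
    fix x assume x: "x \<in> frontier \<Omega>"
    have "norm (x - z) \<le> D" using diameter(2)[of x z] x z by (simp add: frontier_eq)
    then have "C * (norm (x - z) * norm (x - z)) \<le> C * (D * norm (x - z))"
      using F_bound(1) by (intro mult_left_mono mult_right_mono) auto
    moreover have "0 \<le> C * (D * norm (x - z))" "0 \<le> norm (x - z)"
      using F_bound(1) diameter(1) by simp_all
    ultimately have *: "2 * M / r * norm (x - z) \<le> K * norm (x - z) - C * (norm (x - z))\<^sup>2"
      unfolding K_def distrib_right power2_eq_square mult.assoc by linarith
    show "\<bar>b x - b z\<bar> \<le> e + (K * norm (x - z) - C * (norm (x - z))\<^sup>2)"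
    proof (cases "dist x z < r")
      case True
      moreover have "0 \<le> 2 * M / r * norm (x - z)" using M r(1) by simp
      ultimately show ?thesis using r(2)[OF x] * by fastforce
    next
      case False
      then have "2 * M / r * r \<le> 2 * M / r * norm (x - z)"
        using M r(1) by (intro mult_left_mono) (auto simp: dist_norm)
      then have "2 * M \<le> 2 * M / r * norm (x - z)" using r(1) by simp
      then show ?thesis using bounds(3)[OF x] bounds(3)[OF z] * e by linarith
    qed
  qed
qed

lemma slope_at_least_one:
  assumes "2 * C * D + 1 \<le> K" "x \<in> closure \<Omega>" "z \<in> closure \<Omega>"
  shows "1 \<le> K - 2 * C * norm (x - z)"
proof -
  have "C * norm (x - z) \<le> C * D" using diameter(2)[OF assms(2,3)] F_bound(1) by simp
  then show ?thesis using assms(1) by linarith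
qed

text \<open>
  Every member of the class is compared with the same cone with vertex \<open>z\<close>; this also works when the
  boundary is irregular at \<open>z\<close>, since a cone is a barrier with respect to any set not containing its vertex.
\<close>

lemma envelope_le_boundary_cone:
  assumes z: "z \<in> frontier \<Omega>" and K: "2 * C * D + 1 \<le> K"
    and bd: "\<And>x. x \<in> frontier \<Omega> \<Longrightarrow> \<bar>b x - b z\<bar> \<le> e + (K * norm (x - z) - C * (norm (x - z))\<^sup>2)"
    and x: "x \<in> \<Omega>"
  shows "envelope x \<le> b z + e + (K * norm (x - z) - C * (norm (x - z))\<^sup>2)"
proof (rule envelope_le[OF x])
  fix w assume w: "w \<in> subs"
  show "w x \<le> b z + e + (K * norm (x - z) - C * (norm (x - z))\<^sup>2)"
  proof (rule cone_comparison[where S = \<Omega> and T = \<Omega> and N = "closure \<Omega>" and F = F])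
    show "w x \<le> b z + e + (K * norm (x - z) - C * (norm (x - z))\<^sup>2)" if "x \<in> closure \<Omega> - \<Omega>" for x
    proof -
      have "x \<in> frontier \<Omega>" using that by (simp add: frontier_eq)
      then have "w x \<le> b x" "\<bar>b x - b z\<bar> \<le> e + (K * norm (x - z) - C * (norm (x - z))\<^sup>2)"
        using w bd by (auto simp: subs_def)
      then show ?thesis by linarith
    qed
    show "1 \<le> K - 2 * C * norm (x - z)" if "x \<in> \<Omega>" for x
      using slope_at_least_one[OF K] that z closure_subset by (auto simp: frontier_eq)
    show "x \<in> closure \<Omega>" using x closure_subset by blast
  qed (use w domain z F_bound(1) subs_F_bound closure_subset in \<open>auto simp: subs_def frontier_eq\<close>)
qed

text \<open>
  The inverted cone is not itself a member of the class, since it may drop below \<open>W\<close>, where \<open>F\<close> is not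
  controlled by \<open>C\<close>. Its maximum with \<open>W\<close> is one.
\<close>

lemma boundary_cone_le_envelope:
  assumes z: "z \<in> frontier \<Omega>" and K: "2 * C * D + 1 \<le> K" and e: "e > 0"
    and bd: "\<And>x. x \<in> frontier \<Omega> \<Longrightarrow> \<bar>b x - b z\<bar> \<le> e + (K * norm (x - z) - C * (norm (x - z))\<^sup>2)"
    and x: "x \<in> \<Omega>"
  shows "b z - e - (K * norm (x - z) - C * (norm (x - z))\<^sup>2) \<le> envelope x"
proof -
  define L where "L x = b z - e - (K * norm (x - z) - C * (norm (x - z))\<^sup>2)" for x
  have zc: "z \<in> closure \<Omega>" "z \<notin> \<Omega>" using z by (auto simp: frontier_eq)
  have L_le: "L x \<le> b z" if "x \<in> closure \<Omega>" for x
  proof -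
    have "0 \<le> C * norm (x - z)" using F_bound(1) by simp
    then have "0 \<le> norm (x - z) * (K - C * norm (x - z))"
      using slope_at_least_one[OF K that zc(1)] by (intro mult_nonneg_nonneg) auto
    then show ?thesis using e by (simp add: L_def algebra_simps power2_eq_square)
  qed
  define w where "w x = max (L x) (W x)" for x
  have cont: "continuous_on (closure \<Omega>) w"
    unfolding w_def L_def by (intro continuous_intros W(2))
  have at: "visc_ge_at \<Omega> F w p" if p: "p \<in> \<Omega>" for p
  proof (cases "W p \<le> L p")
    case True
    then have wp: "w p = L p" by (simp add: w_def)
    have pc: "p \<in> closure \<Omega>" using p closure_subset by blast
    have "\<bar>L p\<bar> \<le> M" using True L_le[OF pc] bounds(1)[OF p] bounds(3)[OF z] by linarith
    then have FC: "F p (L p) \<le> C" using F_bound(2)[OF p, of "L p"] by linarith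
    have "visc_ge_at \<Omega> F L p"
      unfolding visc_ge_at_def
    proof (intro allI impI)
      fix \<psi> assume \<psi>: "C2_on \<Omega> \<psi>" "local_max_in \<Omega> (\<lambda>x. L x - \<psi> x) p"
      have "C \<le> inf_laplacian \<psi> p"
        using inverted_cone_subsolution[OF domain(1) \<psi>(1) F_bound(1) _ slope_at_least_one[OF K pc zc(1)], of "b z - e"]
          \<psi>(2) p zc(2) by (auto simp: L_def)
      then show "F p (L p) \<le> inf_laplacian \<psi> p" using FC by linarith
    qed
    then show ?thesis
      by (rule visc_ge_at_touched_from_below[of _ _ _ _ 1]) (simp_all add: wp, simp add: w_def)
  next
    case False
    have "visc_ge_at \<Omega> F W p" using W(1) p by (simp add: visc_ge_iff_at)
    then show ?thesis
      by (rule visc_ge_at_touched_from_below[of _ _ _ _ 1]) (use False in \<open>auto simp: w_def\<close>)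
  qed
  have "w \<in> subs"
    unfolding subs_def
  proof (intro CollectI conjI ballI)
    show "visc_ge \<Omega> F w"
      using at cont closure_subset by (auto simp: visc_ge_iff_at intro: continuous_on_subset)
    show "W x \<le> w x" for x by (simp add: w_def)
    show "w x \<le> V x" if "x \<in> \<Omega>" for x
      using L_le[of x] separation(2)[OF that z] W_le_V[OF that] that closure_subset by (fastforce simp: w_def)
    show "w x \<le> b x" if "x \<in> frontier \<Omega>" for x
      using bd[OF that] separation(1)[OF _ that, of x] that by (auto simp: w_def L_def frontier_eq)
  qed (rule cont)
  then show ?thesis using subs_le_envelope[of w x] x by (simp add: w_def L_def)
qed

lemma continuous_on_closure_envelope: "continuous_on (closure \<Omega>) envelope"
  unfolding continuous_on_eq_continuous_within
proof
  fix z assume zc: "z \<in> closure \<Omega>"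
  show "continuous (at z within closure \<Omega>) envelope"
  proof (cases "z \<in> \<Omega>")
    case True
    then show ?thesis
      using continuous_on_envelope domain(1) continuous_on_eq_continuous_at continuous_at_imp_continuous_at_within by blast
  next
    case False
    then have z: "z \<in> frontier \<Omega>" using zc by (simp add: frontier_eq)
    show ?thesis
      unfolding continuous_within_eps_delta
    proof (intro allI impI)
      fix e :: real assume e: "e > 0"
      then have e2: "e / 2 > 0" by simp
      obtain K where K: "2 * C * D + 1 \<le> K"
        "\<And>x. x \<in> frontier \<Omega> \<Longrightarrow> \<bar>b x - b z\<bar> \<le> e / 2 + (K * norm (x - z) - C * (norm (x - z))\<^sup>2)"
        using boundary_cone[OF z e2] by blast
      have "0 < C * D" using F_bound(1) diameter(1) by simp
      then have "0 < K" using K(1) by linarith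
      have est: "\<bar>envelope x - b z\<bar> \<le> e / 2 + K * norm (x - z)" if x: "x \<in> closure \<Omega>" for x
      proof -
        have "\<bar>envelope x - b z\<bar> \<le> e / 2 + (K * norm (x - z) - C * (norm (x - z))\<^sup>2)"
        proof (cases "x \<in> \<Omega>")
          case True
          then show ?thesis
            using envelope_le_boundary_cone[OF z K True] boundary_cone_le_envelope[OF z K(1) e2 K(2) True] by linarith
        next
          case False
          then have "x \<in> frontier \<Omega>" using x by (simp add: frontier_eq)
          then show ?thesis using K(2) by (simp add: envelope_frontier)
        qed
        moreover have "0 \<le> C * (norm (x - z))\<^sup>2" using F_bound(1) by simp
        ultimately show ?thesis by linarith
      qed
      show "\<exists>d>0. \<forall>x\<in>closure \<Omega>. dist x z < d \<longrightarrow> dist (envelope x) (envelope z) < e"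
      proof (intro exI[of _ "e / (2 * K)"] conjI ballI impI)
        show "0 < e / (2 * K)" using e \<open>0 < K\<close> by simp
        fix x assume x: "x \<in> closure \<Omega>" "dist x z < e / (2 * K)"
        then have "K * norm (x - z) < e / 2" using \<open>0 < K\<close> by (simp add: dist_norm field_simps)
        then show "dist (envelope x) (envelope z) < e" using est[OF x(1)] by (simp add: envelope_frontier[OF z] dist_real_def)
      qed
    qed
  qed
qed

text \<open>
  If the inequality failed for a test function \<open>\<psi>\<close> at \<open>p\<close>, it would fail strictly, hence also for all points
  and values near \<open>(p, envelope p)\<close> and for the perturbed \<open>\<psi>1\<close>. A member \<open>w\<close> of the class that almost attains
  the supremum at \<open>p\<close> attains the maximum of \<open>w - \<psi>1\<close> at such a nearby point, a contradiction.
\<close>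

lemma envelope_visc_ge_at:
  assumes p: "p \<in> \<Omega>"
  shows "visc_ge_at \<Omega> F envelope p"
  unfolding visc_ge_at_def
proof (intro allI impI)
  fix \<psi> assume \<psi>: "C2_on \<Omega> \<psi>" and max: "local_max_in \<Omega> (\<lambda>x. envelope x - \<psi> x) p"
  define \<psi>1 where "\<psi>1 x = \<psi> x + 1 * norm (x - p) ^ 4" for x
  have \<psi>1: "C2_on \<Omega> \<psi>1" "inf_laplacian \<psi>1 p = inf_laplacian \<psi> p" "\<psi>1 p = \<psi> p"
    using quartic_perturbation[OF domain(1) \<psi> p, of 1] by (simp_all add: \<psi>1_def[abs_def])
  show "F p (envelope p) \<le> inf_laplacian \<psi> p"
  proof (rule ccontr)
    assume "\<not> F p (envelope p) \<le> inf_laplacian \<psi> p"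
    then have pos: "0 < F p (envelope p) - inf_laplacian \<psi>1 p" by (simp add: \<psi>1)
    have "continuous_on (\<Omega> \<times> UNIV) (\<lambda>z. (case z of (x, t) \<Rightarrow> F x t) - inf_laplacian \<psi>1 (fst z))"
      using continuous_on_inf_laplacian[OF \<psi>1(1)]
      by (intro continuous_intros F continuous_on_compose2[of \<Omega> "inf_laplacian \<psi>1" _ fst]) auto
    then have cont: "continuous_on (\<Omega> \<times> UNIV) (\<lambda>(x, t). F x t - inf_laplacian \<psi>1 x)"
      by (simp add: case_prod_beta')
    obtain r where r: "r > 0" "ball p r \<subseteq> \<Omega>"
      "\<And>x t. x \<in> ball p r \<Longrightarrow> \<bar>t - envelope p\<bar> < r \<Longrightarrow> 0 < F x t - inf_laplacian \<psi>1 x"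
      by (rule positive_nearby[where G = "\<lambda>x t. F x t - inf_laplacian \<psi>1 x" and ?t0.0 = "envelope p",
            OF domain(1) cont p pos]) blast
    obtain r1 where r1: "r1 > 0" "\<And>x. x \<in> \<Omega> \<inter> ball p r1 \<Longrightarrow> envelope x - \<psi> x \<le> envelope p - \<psi> p"
      using max by (auto simp: local_max_in_def)
    obtain r2 where r2: "r2 > 0" "\<And>x. x \<in> ball p r2 \<Longrightarrow> \<bar>envelope x - envelope p\<bar> < r"
      using near_value[OF domain(1) continuous_on_envelope p r(1)] by blast
    obtain r3 where r3: "r3 > 0" "\<And>x. x \<in> ball p r3 \<Longrightarrow> \<bar>\<psi>1 x - \<psi>1 p\<bar> < r / 2"
      using near_value[OF domain(1) C2_on_imp_continuous_on[OF \<psi>1(1)] p, of "r / 2"] r(1) by auto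
    define \<rho> where "\<rho> = Min {r, r1, r2, r3} / 2"
    have \<rho>: "\<rho> > 0" "cball p \<rho> \<subseteq> ball p r" "cball p \<rho> \<subseteq> ball p r1" "cball p \<rho> \<subseteq> ball p r2"
      "cball p \<rho> \<subseteq> ball p r3"
      using r(1) r1(1) r2(1) r3(1) by (auto simp: \<rho>_def)
    \<comment> \<open>The fourth power of \<open>\<rho>\<close> is the gain from the perturbation on the sphere; a smaller defect at \<open>p\<close>
      forces the maximum into the open ball.\<close>
    define \<tau> where "\<tau> = min (\<rho> ^ 4) (r / 2)"
    have \<tau>: "\<tau> > 0" "\<tau> \<le> \<rho> ^ 4" "\<tau> \<le> r / 2" using \<rho>(1) r(1) by (auto simp: \<tau>_def)
    obtain w where w: "w \<in> subs" "envelope p - \<tau> < w p" by (rule envelope_approx[OF p \<tau>(1)])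
    have sub: "cball p \<rho> \<subseteq> \<Omega>" using \<rho>(2) r(2) by blast
    have "continuous_on (cball p \<rho>) (\<lambda>x. w x - \<psi>1 x)"
      using w(1) C2_on_imp_continuous_on[OF \<psi>1(1)] sub closure_subset
      by (intro continuous_intros) (auto simp: subs_def intro: continuous_on_subset)
    then obtain m where m: "m \<in> cball p \<rho>" "\<And>x. x \<in> cball p \<rho> \<Longrightarrow> w x - \<psi>1 x \<le> w m - \<psi>1 m"
      using continuous_attains_sup[of "cball p \<rho>" "\<lambda>x. w x - \<psi>1 x"] \<rho>(1) by fastforce
    have mO: "m \<in> \<Omega>" using m(1) sub by blast
    have wm: "w p - \<psi> p \<le> w m - \<psi> m - norm (m - p) ^ 4"
      using m(2)[of p] \<rho>(1) by (simp add: \<psi>1_def)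
    have "envelope m - \<psi> m \<le> envelope p - \<psi> p" using r1(2)[of m] m(1) \<rho>(3) mO by blast
    then have "norm (m - p) ^ 4 < \<tau>" using wm w(2) subs_le_envelope[OF w(1) mO] by linarith
    then have "norm (m - p) ^ 4 < \<rho> ^ 4" using \<tau>(2) by linarith
    then have "norm (m - p) < \<rho>" using \<rho>(1) power_less_imp_less_base by fastforce
    then have "m \<in> ball p \<rho>" by (simp add: dist_norm norm_minus_commute)
    then obtain d where d: "d > 0" "ball m d \<subseteq> ball p \<rho>" using open_contains_ball open_ball by blast
    have "local_max_in \<Omega> (\<lambda>x. w x - \<psi>1 x) m"
      unfolding local_max_in_def using mO d m(2) by (intro conjI exI[of _ d]) auto
    then have "F m (w m) \<le> inf_laplacian \<psi>1 m"
      using w(1) \<psi>1(1) by (auto simp: subs_def visc_ge_def)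
    moreover have "\<bar>w m - envelope p\<bar> < r"
    proof -
      have near: "m \<in> ball p r2" "m \<in> ball p r3" using m(1) \<rho>(4,5) by blast+
      have "envelope m < envelope p + r" "\<psi>1 p - r / 2 < \<psi>1 m" using r2(2)[OF near(1)] r3(2)[OF near(2)] by linarith+
      moreover have "w p - \<psi>1 p \<le> w m - \<psi>1 m" using m(2)[of p] \<rho>(1) by simp
      ultimately show ?thesis using w(2) subs_le_envelope[OF w(1) mO] \<tau>(3) by linarith
    qed
    moreover have "m \<in> ball p r" using m(1) \<rho>(2) by blast
    ultimately show False using r(3) by fastforce
  qed
qed

lemma envelope_in_subs: "envelope \<in> subs"
  using continuous_on_closure_envelope continuous_on_envelope envelope_visc_ge_at envelope_between envelope_frontier
  by (auto simp: subs_def visc_ge_iff_at)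

text \<open>
  If the supersolution property fails at \<open>q\<close> for \<open>\<psi>\<close>, then \<open>\<psi>\<close> is a strict classical subsolution near \<open>q\<close>.
  Where the envelope is strictly below \<open>V\<close>, it could be increased by a bump formed from \<open>\<psi>\<close>,
  contradicting maximality; where it equals \<open>V\<close>, the function \<open>\<psi>\<close> also touches \<open>V\<close> from below, and
  the supersolution property of \<open>V\<close> applies.
\<close>

lemma envelope_visc_le: "visc_le \<Omega> F envelope"
  unfolding visc_le_def
proof (intro conjI allI impI continuous_on_envelope)
  fix \<psi> q assume \<psi>: "C2_on \<Omega> \<psi>" and min: "local_min_in \<Omega> (\<lambda>x. envelope x - \<psi> x) q"
  have q: "q \<in> \<Omega>" using min by (simp add: local_min_in_def)
  obtain r1 where r1: "r1 > 0" "\<And>x. x \<in> \<Omega> \<inter> ball q r1 \<Longrightarrow> envelope q - \<psi> q \<le> envelope x - \<psi> x"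
    using min by (auto simp: local_min_in_def)
  show "inf_laplacian \<psi> q \<le> F q (envelope q)"
  proof (cases "envelope q < V q")
    case False
    then have eq: "V q = envelope q" using envelope_between(2)[OF q] by simp
    have "local_min_in \<Omega> (\<lambda>x. V x - \<psi> x) q"
      unfolding local_min_in_def
    proof (intro conjI exI[of _ r1] ballI)
      fix x assume "x \<in> \<Omega> \<inter> ball q r1"
      then show "V q - \<psi> q \<le> V x - \<psi> x" using r1(2)[of x] envelope_between(2)[of x] eq by auto
    qed (use q r1 in auto)
    then show ?thesis using V \<psi> by (auto simp: visc_le_def eq[symmetric])
  next
    case True
    show ?thesis
    proof (rule ccontr)
      assume neg: "\<not> inf_laplacian \<psi> q \<le> F q (envelope q)"
      define \<psi>1 where "\<psi>1 x = \<psi> x + (-1) * norm (x - q) ^ 4" for x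
      have \<psi>1: "C2_on \<Omega> \<psi>1" "inf_laplacian \<psi>1 q = inf_laplacian \<psi> q" "\<psi>1 q = \<psi> q"
        using quartic_perturbation[OF domain(1) \<psi> q, of "-1"] by (simp_all add: \<psi>1_def[abs_def])
      have pos: "0 < inf_laplacian \<psi>1 q - F q (envelope q)" using neg by (simp add: \<psi>1)
      have "continuous_on (\<Omega> \<times> UNIV) (\<lambda>z. inf_laplacian \<psi>1 (fst z) - (case z of (x, t) \<Rightarrow> F x t))"
        using continuous_on_inf_laplacian[OF \<psi>1(1)]
        by (intro continuous_intros F continuous_on_compose2[of \<Omega> "inf_laplacian \<psi>1" _ fst]) auto
      then have contG: "continuous_on (\<Omega> \<times> UNIV) (\<lambda>(x, t). inf_laplacian \<psi>1 x - F x t)"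
        by (simp add: case_prod_beta')
      obtain r where r: "r > 0" "ball q r \<subseteq> \<Omega>"
        "\<And>x t. x \<in> ball q r \<Longrightarrow> \<bar>t - envelope q\<bar> < r \<Longrightarrow> 0 < inf_laplacian \<psi>1 x - F x t"
        by (rule positive_nearby[where G = "\<lambda>x t. inf_laplacian \<psi>1 x - F x t" and ?t0.0 = "envelope q",
              OF domain(1) contG q pos]) blast
      define \<gamma> where "\<gamma> = V q - envelope q"
      have \<gamma>: "\<gamma> > 0" using True by (simp add: \<gamma>_def)
      obtain r2 where r2: "r2 > 0" "\<And>x. x \<in> ball q r2 \<Longrightarrow> \<bar>V x - V q\<bar> < \<gamma> / 3"
        using near_value[OF domain(1) _ q, of V "\<gamma> / 3"] V \<gamma> by (auto simp: visc_le_def)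
      obtain r3 where r3: "r3 > 0" "\<And>x. x \<in> ball q r3 \<Longrightarrow> \<bar>\<psi>1 x - \<psi>1 q\<bar> < min (\<gamma> / 3) (r / 2)"
        using near_value[OF domain(1) C2_on_imp_continuous_on[OF \<psi>1(1)] q, of "min (\<gamma> / 3) (r / 2)"] r(1) \<gamma> by auto
      define \<rho> where "\<rho> = Min {r, r1, r2, r3} / 2"
      have \<rho>: "\<rho> > 0" "cball q \<rho> \<subseteq> ball q r" "cball q \<rho> \<subseteq> ball q r1" "cball q \<rho> \<subseteq> ball q r2"
        "cball q \<rho> \<subseteq> ball q r3"
        using r(1) r1(1) r2(1) r3(1) by (auto simp: \<rho>_def)
      \<comment> \<open>The bump is raised by \<open>\<tau>\<close> at \<open>q\<close>: little enough to stay below the envelope on the sphere, within the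
        range where the strict inequality persists, and below \<open>V\<close>.\<close>
      define \<tau> where "\<tau> = Min {\<rho> ^ 4, r / 2, \<gamma> / 3}"
      have \<tau>: "\<tau> > 0" "\<tau> \<le> \<rho> ^ 4" "\<tau> \<le> r / 2" "\<tau> \<le> \<gamma> / 3"
        using \<rho>(1) r(1) \<gamma> by (auto simp: \<tau>_def)
      have sub: "cball q \<rho> \<subseteq> \<Omega>" using \<rho>(2) r(2) by blast
      define B where "B x = \<psi>1 x + (envelope q - \<psi> q + \<tau>)" for x
      define U where "U x = (if x \<in> cball q \<rho> then max (envelope x) (B x) else envelope x)" for x
      have envelope_le_U: "envelope x \<le> U x" for x by (simp add: U_def)
      have sphere: "B x \<le> envelope x" if x: "x \<in> cball q \<rho>" "x \<notin> ball q \<rho>" for x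
      proof -
        have "norm (x - q) = \<rho>" using x by (auto simp: dist_norm norm_minus_commute)
        moreover have "envelope q - \<psi> q \<le> envelope x - \<psi> x" using r1(2)[of x] x(1) sub \<rho>(3) by blast
        ultimately show ?thesis using \<tau>(2) by (simp add: B_def \<psi>1_def)
      qed
      have near: "\<bar>\<psi>1 x - \<psi> q\<bar> < \<gamma> / 3" "\<bar>\<psi>1 x - \<psi> q\<bar> < r / 2" "\<bar>V x - V q\<bar> < \<gamma> / 3"
        if x: "x \<in> cball q \<rho>" for x
        using r3(2)[of x] r2(2)[of x] x \<rho>(4,5) \<psi>1(3) by auto
      have cont: "continuous_on (closure \<Omega>) U"
      proof -
        have "closed (cball q \<rho>)" "closed (closure \<Omega> - ball q \<rho>)" by auto
        moreover have "continuous_on (cball q \<rho>) (\<lambda>x. max (envelope x) (B x))"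
          unfolding B_def using sub
          by (intro continuous_intros continuous_on_subset[OF continuous_on_envelope]
              continuous_on_subset[OF C2_on_imp_continuous_on[OF \<psi>1(1)]])
        moreover have "continuous_on (closure \<Omega> - ball q \<rho>) envelope"
          by (rule continuous_on_subset[OF continuous_on_closure_envelope]) auto
        moreover have "\<forall>x. x \<in> cball q \<rho> \<and> x \<notin> cball q \<rho> \<or> x \<in> closure \<Omega> - ball q \<rho> \<and> x \<in> cball q \<rho>
            \<longrightarrow> max (envelope x) (B x) = envelope x"
          using sphere by (auto intro!: max_absorb1)
        ultimately have "continuous_on (cball q \<rho> \<union> (closure \<Omega> - ball q \<rho>)) (\<lambda>x. if x \<in> cball q \<rho> then max (envelope x) (B x) else envelope x)"
          by (rule continuous_on_cases)
        moreover have "closure \<Omega> \<subseteq> cball q \<rho> \<union> (closure \<Omega> - ball q \<rho>)" by auto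
        ultimately show ?thesis
          using continuous_on_subset by (auto simp: U_def[abs_def])
      qed
      have at: "visc_ge_at \<Omega> F U p" if p: "p \<in> \<Omega>" for p
      proof (cases "U p = envelope p")
        case True
        show ?thesis
          by (rule visc_ge_at_touched_from_below[OF envelope_visc_ge_at[OF p], of 1]) (simp_all add: envelope_le_U True)
      next
        case False
        then have pc: "p \<in> cball q \<rho>" and UB: "U p = B p" and "envelope p < B p"
          by (auto simp: U_def max_def split: if_splits)
        then have "p \<in> ball q \<rho>" using sphere[of p] by force
        then obtain d where d: "d > 0" "ball p d \<subseteq> ball q \<rho>" using open_contains_ball open_ball by blast
        have "visc_ge_at \<Omega> F B p"
          unfolding visc_ge_at_def
        proof (intro allI impI)
          fix \<phi> assume \<phi>: "C2_on \<Omega> \<phi>" "local_max_in \<Omega> (\<lambda>x. B x - \<phi> x) p"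
          have "local_max_in \<Omega> (\<lambda>x. \<psi>1 x - \<phi> x) p"
            using \<phi>(2) by (auto simp: local_max_in_def B_def)
          then have "inf_laplacian \<psi>1 p \<le> inf_laplacian \<phi> p"
            by (rule inf_laplacian_mono_at_local_max[OF domain(1) \<psi>1(1) \<phi>(1)])
          moreover have "\<bar>B p - envelope q\<bar> < r"
            using near(2)[OF pc] \<tau>(1,3) unfolding B_def by linarith
          then have "0 < inf_laplacian \<psi>1 p - F p (B p)" using pc \<rho>(2) by (intro r(3)) auto
          ultimately show "F p (B p) \<le> inf_laplacian \<phi> p" by linarith
        qed
        then show ?thesis
        proof (rule visc_ge_at_touched_from_below)
          show "d > 0" "U p = B p" by (fact d(1), fact UB)
          fix x assume "x \<in> \<Omega> \<inter> ball p d"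
          then have "x \<in> cball q \<rho>" using d(2) ball_subset_cball by blast
          then show "B x \<le> U x" by (simp add: U_def)
        qed
      qed
      have "U \<in> subs"
        unfolding subs_def
      proof (intro CollectI conjI ballI)
        show "visc_ge \<Omega> F U"
          using at cont closure_subset by (auto simp: visc_ge_iff_at intro: continuous_on_subset)
        fix x assume x: "x \<in> \<Omega>"
        show "W x \<le> U x" using envelope_between(1)[OF x] envelope_le_U[of x] by linarith
        show "U x \<le> V x"
        proof (cases "x \<in> cball q \<rho>")
          case True
          have "B x \<le> V x" using near(1,3)[OF True] \<tau>(4) \<gamma>_def unfolding B_def by linarith
          then show ?thesis using envelope_between(2)[OF x] by (simp add: U_def)
        qed (use envelope_between(2)[OF x] in \<open>simp add: U_def\<close>)
      next
        fix z assume z: "z \<in> frontier \<Omega>"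
        then have "z \<notin> cball q \<rho>" using sub frontier_eq by blast
        then show "U z \<le> b z" using envelope_frontier[OF z] by (simp add: U_def)
      qed (rule cont)
      then have "U q \<le> envelope q" using q by (rule subs_le_envelope)
      then show False using \<tau>(1) \<rho>(1) \<psi>1(3) by (simp add: U_def B_def)
    qed
  qed
qed

theorem envelope_solves: "continuous_on (closure \<Omega>) envelope" "visc_solution \<Omega> F envelope" "\<And>z. z \<in> frontier \<Omega> \<Longrightarrow> envelope z = b z"
  using envelope_in_subs envelope_visc_le envelope_frontier by (auto simp: visc_solution_def subs_def)

end

section \<open>Bounds and scaling\<close>

text \<open>
  A continuous function on an open set cannot exceed its essential bound anywhere: the set where it does
  is open, and nonempty open sets have positive measure.
\<close>

lemma Linfty_on_imp_bounded:
  fixes f :: "real ^ 'n::finite \<Rightarrow> real"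
  assumes "open S" "continuous_on S f" "Linfty_on S f"
  obtains B where "B > 0" "\<And>x. x \<in> S \<Longrightarrow> \<bar>f x\<bar> \<le> B"
proof -
  obtain C where ae: "AE x in lebesgue_on S. \<bar>f x\<bar> \<le> C"
    using assms(3) by (auto simp: Linfty_on_def)
  have S: "S \<in> sets lebesgue" using assms(1) by (simp add: borel_open)
  define N where "N = {x \<in> S. C < \<bar>f x\<bar>}"
  have "open {x \<in> S. \<bar>f x\<bar> \<in> {C<..}}"
    using continuous_open_preimage[of S "\<lambda>x. \<bar>f x\<bar>" "{C<..}"] assms(1,2)
    by (simp add: continuous_intros vimage_def Int_def)
  then have N: "open N" by (simp add: N_def)
  have "AE x in lebesgue. x \<in> S \<longrightarrow> \<bar>f x\<bar> \<le> C"
    using ae AE_restrict_space_iff[of S lebesgue] S by simp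
  then have "AE x in lebesgue. x \<notin> N" by (rule AE_mp) (auto simp: N_def)
  then have "N \<in> null_sets lebesgue"
    using N by (subst AE_iff_null_sets) (auto simp: borel_open)
  then have "negligible N" by (simp add: negligible_iff_null_sets)
  then have "N = {}" using N open_not_negligible by blast
  then show thesis by (intro that[of "max 1 C"]) (force simp: N_def)+
qed

text \<open>
  The infinity-Laplacian is homogeneous of degree three and odd, so a negative multiple of a
  supersolution is a subsolution of the rescaled equation.
\<close>

lemma scaled_visc_ge:
  assumes "open S" "visc_le S F u" "k < 0" "\<And>x. x \<in> S \<Longrightarrow> G x (k * u x) \<le> k ^ 3 * F x (u x)"
  shows "visc_ge S G (\<lambda>x. k * u x)"
  unfolding visc_ge_def
proof (intro conjI allI impI)
  show "continuous_on S (\<lambda>x. k * u x)"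
    using assms(2) by (auto simp: visc_le_def intro!: continuous_intros)
  fix \<psi> p assume \<psi>: "C2_on S \<psi>" "local_max_in S (\<lambda>x. k * u x - \<psi> x) p"
  have p: "p \<in> S" using \<psi>(2) by (simp add: local_max_in_def)
  have "k * (u x - 1 / k * \<psi> x) = k * u x - \<psi> x" for x using assms(3) by (simp add: field_simps)
  then have "k * (u x - 1 / k * \<psi> x) \<le> k * (u p - 1 / k * \<psi> p) \<longleftrightarrow> k * u x - \<psi> x \<le> k * u p - \<psi> p" for x
    by simp
  then have "local_min_in S (\<lambda>x. u x - 1 / k * \<psi> x) p"
    using \<psi>(2) assms(3) by (simp add: local_max_in_def local_min_in_def)
  then have "inf_laplacian (\<lambda>x. 1 / k * \<psi> x) p \<le> F p (u p)"
    using assms(2) inf_laplacian_scale(1)[OF assms(1) \<psi>(1) p] unfolding visc_le_def by blast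
  then have "(1 / k) ^ 3 * inf_laplacian \<psi> p \<le> F p (u p)"
    using inf_laplacian_scale(2)[OF assms(1) \<psi>(1) p] by metis
  then have "k ^ 3 * F p (u p) \<le> k ^ 3 * ((1 / k) ^ 3 * inf_laplacian \<psi> p)"
    using assms(3) by (intro mult_left_mono_neg) (auto simp: power_le_zero_eq)
  also have "\<dots> = inf_laplacian \<psi> p" using assms(3) by (simp add: power_divide)
  finally show "G p (k * u p) \<le> inf_laplacian \<psi> p" using assms(4)[OF p] by linarith
qed

lemma scaled_visc_le:
  assumes "open S" "visc_le S F u" "0 < k" "\<And>x. x \<in> S \<Longrightarrow> k ^ 3 * F x (u x) \<le> G x (k * u x)"
  shows "visc_le S G (\<lambda>x. k * u x)"
  unfolding visc_le_def
proof (intro conjI allI impI)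
  show "continuous_on S (\<lambda>x. k * u x)"
    using assms(2) by (auto simp: visc_le_def intro!: continuous_intros)
  fix \<psi> p assume \<psi>: "C2_on S \<psi>" "local_min_in S (\<lambda>x. k * u x - \<psi> x) p"
  have p: "p \<in> S" using \<psi>(2) by (simp add: local_min_in_def)
  have "k * (u x - 1 / k * \<psi> x) = k * u x - \<psi> x" for x using assms(3) by (simp add: field_simps)
  then have "k * (u p - 1 / k * \<psi> p) \<le> k * (u x - 1 / k * \<psi> x) \<longleftrightarrow> k * u p - \<psi> p \<le> k * u x - \<psi> x" for x
    by simp
  then have "local_min_in S (\<lambda>x. u x - 1 / k * \<psi> x) p"
    using \<psi>(2) assms(3) by (simp add: local_min_in_def)
  then have "inf_laplacian (\<lambda>x. 1 / k * \<psi> x) p \<le> F p (u p)"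
    using assms(2) inf_laplacian_scale(1)[OF assms(1) \<psi>(1) p] unfolding visc_le_def by blast
  then have "(1 / k) ^ 3 * inf_laplacian \<psi> p \<le> F p (u p)"
    using inf_laplacian_scale(2)[OF assms(1) \<psi>(1) p] by metis
  then have "k ^ 3 * ((1 / k) ^ 3 * inf_laplacian \<psi> p) \<le> k ^ 3 * F p (u p)"
    using assms(3) by (intro mult_left_mono) auto
  then have "inf_laplacian \<psi> p \<le> k ^ 3 * F p (u p)" using assms(3) by (simp add: power_divide)
  then show "inf_laplacian \<psi> p \<le> G p (k * u p)" using assms(4)[OF p] by linarith
qed

section \<open>Solvability below the principal eigenvalue\<close>

theorem theorem3p10:
  fixes \<Omega> :: "(real ^ 'n::finite) set"
    and a h b :: "real ^ 'n \<Rightarrow> real"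
    and \<mu> \<delta> :: real
  assumes dim: "CARD('n) \<ge> 2"
    and domain: "open \<Omega>" "connected \<Omega>" "\<Omega> \<noteq> {}" "bounded \<Omega>"
    and a: "continuous_on \<Omega> a" "Linfty_on \<Omega> a" "(INF x\<in>\<Omega>. a x) > 0"
    and \<delta>: "\<delta> > 0"
    and \<mu>: "0 \<le> \<mu>" "ereal \<mu> < principal_eigenvalue \<delta> \<Omega> a"
    and h: "continuous_on \<Omega> h" "Linfty_on \<Omega> h"
    and b: "continuous_on (frontier \<Omega>) b"
  shows "\<exists>u. dirichlet_solution \<Omega> a \<mu> h b u"
proof -
  obtain \<mu>' v where \<mu>': "\<mu> < \<mu>'" and v: "dirichlet_solution \<Omega> a \<mu>' (\<lambda>_. 0) (\<lambda>_. \<delta>) v"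
    "\<And>x. x \<in> \<Omega> \<Longrightarrow> 0 < v x"
    using \<mu>(2) by (auto simp: principal_eigenvalue_def less_Sup_iff eigen_set_def)
  have v_cont: "continuous_on (closure \<Omega>) v" and v_le: "visc_le \<Omega> (\<lambda>x t. 0 - \<mu>' * a x * t ^ 3) v"
    and v_bd: "\<And>z. z \<in> frontier \<Omega> \<Longrightarrow> v z = \<delta>"
    using v(1) by (auto simp: dirichlet_solution_def visc_solution_def)
  have frontier_eq: "frontier \<Omega> = closure \<Omega> - \<Omega>"
    using domain(1) by (simp add: frontier_def interior_open)
  have cpt: "compact (closure \<Omega>)" "closure \<Omega> \<noteq> {}" using domain by auto
  obtain x0 where x0: "x0 \<in> closure \<Omega>" "\<And>x. x \<in> closure \<Omega> \<Longrightarrow> v x0 \<le> v x"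
    using continuous_attains_inf[OF cpt v_cont] by blast
  obtain x1 where x1: "x1 \<in> closure \<Omega>" "\<And>x. x \<in> closure \<Omega> \<Longrightarrow> v x \<le> v x1"
    using continuous_attains_sup[OF cpt v_cont] by blast
  define m where "m = v x0"
  have m: "0 < m"
    using v(2)[of x0] v_bd[of x0] \<delta> x0(1) frontier_eq by (cases "x0 \<in> \<Omega>") (auto simp: m_def)
  have m_le: "m \<le> v x" "v x \<le> v x1" if "x \<in> closure \<Omega>" for x using x0 x1 that by (auto simp: m_def)
  obtain A where A: "A > 0" "\<And>x. x \<in> \<Omega> \<Longrightarrow> \<bar>a x\<bar> \<le> A" using Linfty_on_imp_bounded[OF domain(1) a(1,2)] by blast
  obtain H where H: "H > 0" "\<And>x. x \<in> \<Omega> \<Longrightarrow> \<bar>h x\<bar> \<le> H" using Linfty_on_imp_bounded[OF domain(1) h] by blast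
  define a0 where "a0 = (INF x\<in>\<Omega>. a x)"
  have a0: "0 < a0" using a(3) by (simp add: a0_def)
  have a0_le: "a0 \<le> a x" if "x \<in> \<Omega>" for x
    unfolding a0_def
  proof (rule cINF_lower[OF _ that])
    show "bdd_below (a ` \<Omega>)" using A(2) by (intro bdd_belowI[of _ "-A"]) (fastforce simp: abs_le_iff)
  qed
  have "compact (frontier \<Omega>)" using domain(4) by (simp add: compact_frontier_bounded)
  then have "bounded (b ` frontier \<Omega>)" using b by (intro compact_imp_bounded compact_continuous_image)
  then obtain Bb where Bb: "Bb > 0" "\<And>z. z \<in> frontier \<Omega> \<Longrightarrow> \<bar>b z\<bar> \<le> Bb"
    unfolding bounded_pos by auto
  \<comment> \<open>The surplus with which \<open>v\<close> is a supersolution for \<open>\<mu>\<close> is at least \<open>c\<close>. It scales with the cube of the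
    multiple of \<open>v\<close>, so for a large multiple it exceeds \<open>H\<close>.\<close>
  define c where "c = (\<mu>' - \<mu>) * a0 * m ^ 3"
  have c: "0 < c" using \<mu>' a0 m by (simp add: c_def)
  define k where "k = Max {1, Bb / m, H / c}"
  have k: "1 \<le> k" "Bb / m \<le> k" "H / c \<le> k" by (simp_all add: k_def)
  have strict: "H \<le> k ^ 3 * ((\<mu>' - \<mu>) * a x * v x ^ 3)" if x: "x \<in> \<Omega>" for x
  proof -
    have xc: "x \<in> closure \<Omega>" using x closure_subset by blast
    have "c \<le> (\<mu>' - \<mu>) * a x * v x ^ 3"
      unfolding c_def using \<mu>' a0 a0_le[OF x] m m_le[OF xc]
      by (intro mult_mono power_mono mult_nonneg_nonneg) auto
    moreover have "k \<le> k ^ 3" using k(1) by (simp add: self_le_power)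
    ultimately have "k * c \<le> k ^ 3 * ((\<mu>' - \<mu>) * a x * v x ^ 3)"
      using k(1) c by (intro mult_mono) auto
    moreover have "H \<le> k * c" using k(3) c by (simp add: field_simps)
    ultimately show ?thesis by linarith
  qed
  define F where "F x t = h x - \<mu> * a x * t ^ 3" for x and t :: real
  have V: "visc_le \<Omega> F (\<lambda>x. k * v x)"
  proof (rule scaled_visc_le[OF domain(1) v_le])
    fix x assume x: "x \<in> \<Omega>"
    show "k ^ 3 * (0 - \<mu>' * a x * v x ^ 3) \<le> F x (k * v x)"
      using strict[OF x] H(2)[OF x] by (simp add: F_def algebra_simps)
  qed (use k in auto)
  have W: "visc_ge \<Omega> F (\<lambda>x. - k * v x)"
  proof (rule scaled_visc_ge[OF domain(1) v_le])
    fix x assume x: "x \<in> \<Omega>"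
    show "F x (- k * v x) \<le> (- k) ^ 3 * (0 - \<mu>' * a x * v x ^ 3)"
      using strict[OF x] H(2)[OF x] by (simp add: F_def algebra_simps)
  qed (use k in auto)
  define M where "M = max (k * v x1) Bb"
  define C where "C = H + \<mu> * A * M ^ 3"
  have kv: "Bb \<le> k * v x" "k * v x \<le> M" if "x \<in> closure \<Omega>" for x
  proof -
    have "Bb \<le> k * m" using k(2) m by (simp add: field_simps)
    also have "k * m \<le> k * v x" using k(1) m_le[OF that] by simp
    finally show "Bb \<le> k * v x" .
    have "k * v x \<le> k * v x1" using k(1) m_le[OF that] by simp
    then show "k * v x \<le> M" by (simp add: M_def)
  qed
  have M: "0 < M" using Bb(1) by (simp add: M_def)
  interpret perron \<Omega> F "\<lambda>x. - k * v x" "\<lambda>x. k * v x" b M C "diameter (closure \<Omega>) + 1"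
  proof
    show "0 < diameter (closure \<Omega>) + 1" using diameter_ge_0[OF bounded_closure[OF domain(4)]] by linarith
    show "norm (x - y) \<le> diameter (closure \<Omega>) + 1" if "x \<in> closure \<Omega>" "y \<in> closure \<Omega>" for x y
      using diameter_bounded_bound[OF bounded_closure[OF domain(4)] that] by (simp add: dist_norm)
    show "continuous_on (\<Omega> \<times> UNIV) (\<lambda>(x, t). F x t)"
      unfolding F_def case_prod_beta'
      by (intro continuous_intros continuous_on_compose2[OF a(1)] continuous_on_compose2[OF h(1)]) auto
    show "0 < C" using H(1) A(1) M \<mu>(1) by (simp add: C_def add_pos_nonneg)
    show "\<bar>F x t\<bar> \<le> C" if x: "x \<in> \<Omega>" and t: "\<bar>t\<bar> \<le> M" for x t
    proof -
      have "\<bar>\<mu> * a x * t ^ 3\<bar> = \<mu> * \<bar>a x\<bar> * \<bar>t\<bar> ^ 3" using \<mu>(1) by (simp add: abs_mult power_abs)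
      also have "\<dots> \<le> \<mu> * A * M ^ 3"
        using \<mu>(1) A t x by (intro mult_mono power_mono mult_nonneg_nonneg) auto
      finally show ?thesis using H(2)[OF x] by (simp add: F_def C_def)
    qed
    show "continuous_on (closure \<Omega>) (\<lambda>x. - k * v x)" by (intro continuous_intros v_cont)
    fix x assume x: "x \<in> \<Omega>"
    then have xc: "x \<in> closure \<Omega>" using closure_subset by blast
    show "- k * v x \<le> k * v x" "- M \<le> - k * v x" "k * v x \<le> M"
      using kv[OF xc] Bb(1) by auto
    show "b z \<le> k * v x" if "z \<in> frontier \<Omega>" for z using kv(1)[OF xc] Bb(2)[OF that] by linarith
  next
    show "- k * v x \<le> b z" if "x \<in> closure \<Omega>" "z \<in> frontier \<Omega>" for x z
      using kv(1)[OF that(1)] Bb(2)[OF that(2)] by simp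
    show "\<bar>b z\<bar> \<le> M" if "z \<in> frontier \<Omega>" for z
      using Bb(2)[OF that] by (simp add: M_def)
  qed (use domain b V W in auto)
  have "dirichlet_solution \<Omega> a \<mu> h b envelope"
    using envelope_solves unfolding dirichlet_solution_def F_def[abs_def] by blast
  then show ?thesis by (rule exI[where x = envelope])
qed

end
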